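(* Let $E,F$ be two pseudo-normed vector spaces, let $a\in\mathbb{R}$ and $q\in[1,+\infty]$. Let $(X^s,\|\cdot\|_{X^s})_{s\ge a}$ and $(Y^s,\|\cdot\|_{Y^s})_{s\ge a}$ be two scales of pseudo-normed vector spaces of type $(q,E)$ and $(q,F)$, respectively. Let $s_0,s,s_1,r$ be real numbers with $a\le s_0<s<s_1$ and $r>0$. Let $B_s(0,r)=\{v\in X^s : \|v\|_{X^s}<r\}$ and let $$\Phi\colon B_s(0,r)\to Y^{s_0}$$ be a mapping satisfying the following two properties. (1) (Contraction) There exists $C_0>0$ such that for all $v,w\in B_s(0,r)$, $$\|\Phi(v)-\Phi(w)\|_{Y^{s_0}_\infty}\le C_0\|v-w\|_{X^{s_0}_1}.$$ (2) (Tame estimate) There exists $C_1>0$ such that for all $v\in X^\infty_1\cap B_s(0,r)$, $$\|\Phi(v)\|_{Y^{s_1}_\infty}\le C_1\|v\|_{X^{s_1}_1}.$$ Then: (1) (Interpolation) $\Phi(v)\in Y^s$ for all $v\in B_s(0,r)$; (2) (Continuity) the mapping $\Phi\colon B_s(0,r)\to Y^s$ is continuous.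
   Context: Pseudo-norm: on a vector space $E$ over $\mathbb{K}=\mathbb{R}$ or $\mathbb{C}$, a functional $\|\cdot\|_E\colon E\to[0,+\infty)$ such that $\|-x\|_E=\|x\|_E$, $\|x+y\|_E\le\|x\|_E+\|y\|_E$, and $\|x\|_E=0$ if and only if $x=0$ (no homogeneity, no completeness is required). A pseudo-normed vector space is a vector space with a pseudo-norm; it carries the topology of the distance $d(x,y)=\|x-y\|_E$. Sequence spaces: for $s\in\mathbb{R}$ and $q\in[1,+\infty)$, $\Sigma^s_q(E)$ is the space of sequences $f=(f_k)_{k\in\mathbb{N}}$ in $E$ with $\|f\|_{\Sigma^s_q}:=\big(\sum_{k}2^{qks}\|f_k\|_E^q\big)^{1/q}<+\infty$; $\Sigma^s_\infty(E)$ is the space of sequences with $\lim_{k\to+\infty}2^{ks}\|f_k\|_E=0$, with $\|f\|_{\Sigma^s_\infty}:=\sup_k2^{ks}\|f_k\|_E$. These are pseudo-norms; the same formulas are used, with values in $[0,+\infty]$, for arbitrary sequences in $E$. Set $\Sigma^\infty_1(E)=\bigcap_{s\in\mathbb{R}}\Sigma^s_1(E)$. Scale of type $(q,E)$: a family $(X^s,\|\cdot\|_{X^s})_{s\ge a}$ of pseudo-normed vector spaces, decreasing in the sense that $s'\ge s\ge a$ implies $X^{s'}\subset X^s$ and $\|\cdot\|_{X^s}\le\|\cdot\|_{X^{s'}}$, is a scale of pseudo-normed vector spaces of type $(q,E)$ if there exist two linear mappings $L\colon X^a\to\Sigma^a_q(E)$ and $R\colon\Sigma^a_q(E)\to X^a$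 such that: (1) $R(Lu)=u$ for all $u\in X^a$; (2) for all $s\ge a$ and all $f\in\Sigma^s_1(E)$, $L(Rf)\in\Sigma^s_1(E)$ and $\|L(Rf)\|_{\Sigma^s_1}\le C(s)\|f\|_{\Sigma^s_1}$; (3) for all $s\ge a$, $L(X^s)\subset\Sigma^s_q(E)$ and $R(\Sigma^s_q(E))\subset X^s$, and there is a constant $C(s)>0$ such that $\|Lu\|_{\Sigma^s_q}\le C(s)\|u\|_{X^s}$ for all $u\in X^s$ and $\|Rf\|_{X^s}\le C(s)\|f\|_{\Sigma^s_q}$ for all $f\in\Sigma^s_q(E)$. For such a scale (with fixed $L$, $R$) and $\sigma\ge a$, one sets, for $u\in X^a$, $\|u\|_{X^\sigma_1}:=\|Lu\|_{\Sigma^\sigma_1}\in[0,+\infty]$ and $\|u\|_{X^\sigma_\infty}:=\|Lu\|_{\Sigma^\sigma_\infty}\in[0,+\infty]$, and $X^\infty_1:=R(\Sigma^\infty_1(E))$. The same notation is used for $Y$, with its own mappings $L,R$ and with $F$ in place of $E$. *)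

theory Defs
  imports "HOL-Analysis.Analysis"
begin

text \<open>
  The scalars are a type of class \<open>real_normed_field\<close>. As the norm of such a field is
  multiplicative, the field is isomorphic to \<open>real\<close> or to \<open>complex\<close>
  (Ostrowski, Gelfand--Mazur), so this class says exactly that the scalar field is R or C.

  A pseudo-normed space is a linear subspace \<open>V\<close> of an ambient vector space with a
  functional \<open>N\<close> of which only the values on \<open>V\<close> matter.
\<close>

locale pseudo_normed_space = vector_space scale
  for scale :: "'k::real_normed_field \<Rightarrow> 'v::ab_group_add \<Rightarrow> 'v" +
  fixes V :: "'v set" and N :: "'v \<Rightarrow> real"
  assumes subspace_carrier: "subspace V"
    and pnorm_nonneg: "x \<in> V \<Longrightarrow> 0 \<le> N x"
    and pnorm_minus: "x \<in> V \<Longrightarrow> N (- x) = N x"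
    and pnorm_triangle: "x \<in> V \<Longrightarrow> y \<in> V \<Longrightarrow> N (x + y) \<le> N x + N y"
    and pnorm_eq_0_iff: "x \<in> V \<Longrightarrow> N x = 0 \<longleftrightarrow> x = 0"

text \<open>
  \<open>Metric_space\<close> asks for nonnegativity and symmetry also outside the carrier; hence the
  value 0 there.
\<close>

definition pnorm_dist :: "'v::ab_group_add set \<Rightarrow> ('v \<Rightarrow> real) \<Rightarrow> 'v \<Rightarrow> 'v \<Rightarrow> real"
  where "pnorm_dist V N x y = (if x \<in> V \<and> y \<in> V then N (x - y) else 0)"

definition pnorm_topology :: "'v::ab_group_add set \<Rightarrow> ('v \<Rightarrow> real) \<Rightarrow> 'v topology"
  where "pnorm_topology V N = Metric_space.mtopology V (pnorm_dist V N)"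

definition pnorm_ball :: "'v set \<Rightarrow> ('v \<Rightarrow> real) \<Rightarrow> real \<Rightarrow> 'v set"
  where "pnorm_ball V N r = {v \<in> V. N v < r}"

lemma (in pseudo_normed_space) Metric_space_pnorm: "Metric_space V (pnorm_dist V N)"
proof
  show "0 \<le> pnorm_dist V N x y" for x y
    by (simp add: pnorm_dist_def pnorm_nonneg subspace_carrier subspace_diff)
  show "pnorm_dist V N x y = pnorm_dist V N y x" for x y
    using pnorm_minus[of "x - y"] by (auto simp: pnorm_dist_def subspace_carrier subspace_diff)
  show "pnorm_dist V N x y = 0 \<longleftrightarrow> x = y" if "x \<in> V" "y \<in> V" for x y
    using that by (simp add: pnorm_dist_def pnorm_eq_0_iff subspace_carrier subspace_diff)
  show "pnorm_dist V N x z \<le> pnorm_dist V N x y + pnorm_dist V N y z"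
    if "x \<in> V" "y \<in> V" "z \<in> V" for x y z
    using that pnorm_triangle[of "x - y" "y - z"]
    by (simp add: pnorm_dist_def subspace_carrier subspace_diff)
qed

text \<open>
  The norm of weighted sequences, for an exponent in \<open>[1, \<infinity>]\<close>, of arbitrary sequences. The
  second conditional is the power \<open>1 / p\<close> of a sum that may be infinite. For the exponent
  \<open>\<infinity>\<close> the space consists of the weighted null sequences, not of all sequences of finite norm.
\<close>

definition Sigma_norm :: "('e \<Rightarrow> real) \<Rightarrow> ennreal \<Rightarrow> real \<Rightarrow> (nat \<Rightarrow> 'e) \<Rightarrow> ennreal"
  where "Sigma_norm N q s f =
    (if q = top then (SUP k. ennreal (2 powr (real k * s) * N (f k)))
     else let p = enn2real q;
              S = (\<Sum>k. ennreal (2 powr (p * real k * s) * N (f k) powr p))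
          in if S = top then top else ennreal (enn2real S powr (1 / p)))"

definition Sigma_space :: "('e \<Rightarrow> real) \<Rightarrow> ennreal \<Rightarrow> real \<Rightarrow> (nat \<Rightarrow> 'e) set"
  where "Sigma_space N q s =
    (if q = top then {f. (\<lambda>k. 2 powr (real k * s) * N (f k)) \<longlonglongrightarrow> 0}
     else {f. Sigma_norm N q s f < top})"

text \<open>
  A scale of type \<open>(q, E)\<close> with its mappings \<open>L\<close> and \<open>R\<close>; \<open>E\<close> is a whole type, and all the
  \<open>X s\<close> are subspaces of one ambient vector space. The families are only constrained for
  \<open>s \<ge> a\<close>. As a pseudo-norm need not be homogeneous, \<open>Sigma_space NE q a\<close> need not be stable
  under scalar multiplication; this is why \<open>R_scale\<close> has a membership premise.
\<close>

locale pseudo_normed_scale = E: pseudo_normed_space scaleE UNIV NE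
  for scaleE :: "'k::real_normed_field \<Rightarrow> 'e::ab_group_add \<Rightarrow> 'e" and NE :: "'e \<Rightarrow> real" +
  fixes scaleX :: "'k \<Rightarrow> 'x::ab_group_add \<Rightarrow> 'x"
    and X :: "real \<Rightarrow> 'x set" and NX :: "real \<Rightarrow> 'x \<Rightarrow> real"
    and a :: real and q :: ennreal
    and L :: "'x \<Rightarrow> nat \<Rightarrow> 'e" and R :: "(nat \<Rightarrow> 'e) \<Rightarrow> 'x"
  assumes q_ge_1: "1 \<le> q"
    and pseudo_normed_X: "s \<ge> a \<Longrightarrow> pseudo_normed_space scaleX (X s) (NX s)"
    and X_decreasing: "s \<ge> a \<Longrightarrow> s' \<ge> s \<Longrightarrow> X s' \<subseteq> X s"
    and NX_increasing: "s \<ge> a \<Longrightarrow> s' \<ge> s \<Longrightarrow> u \<in> X s' \<Longrightarrow> NX s u \<le> NX s' u"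
    and L_mem: "u \<in> X a \<Longrightarrow> L u \<in> Sigma_space NE q a"
    and L_add: "u \<in> X a \<Longrightarrow> v \<in> X a \<Longrightarrow> L (u + v) = (\<lambda>k. L u k + L v k)"
    and L_scale: "u \<in> X a \<Longrightarrow> L (scaleX c u) = (\<lambda>k. scaleE c (L u k))"
    and R_mem: "f \<in> Sigma_space NE q a \<Longrightarrow> R f \<in> X a"
    and R_add: "f \<in> Sigma_space NE q a \<Longrightarrow> g \<in> Sigma_space NE q a \<Longrightarrow>
      R (\<lambda>k. f k + g k) = R f + R g"
    and R_scale: "f \<in> Sigma_space NE q a \<Longrightarrow> (\<lambda>k. scaleE c (f k)) \<in> Sigma_space NE q a \<Longrightarrow>
      R (\<lambda>k. scaleE c (f k)) = scaleX c (R f)"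
    and R_L: "u \<in> X a \<Longrightarrow> R (L u) = u"
    and LR_bound: "s \<ge> a \<Longrightarrow> \<exists>C>0. \<forall>f \<in> Sigma_space NE 1 s.
      L (R f) \<in> Sigma_space NE 1 s \<and>
      Sigma_norm NE 1 s (L (R f)) \<le> ennreal C * Sigma_norm NE 1 s f"
    and L_R_bounds: "s \<ge> a \<Longrightarrow> \<exists>C>0.
      (\<forall>u \<in> X s. L u \<in> Sigma_space NE q s \<and>
        Sigma_norm NE q s (L u) \<le> ennreal (C * NX s u)) \<and>
      (\<forall>f \<in> Sigma_space NE q s. R f \<in> X s \<and>
        ennreal (NX s (R f)) \<le> ennreal C * Sigma_norm NE q s f)"

definition scale_norm ::
    "('e \<Rightarrow> real) \<Rightarrow> ('x \<Rightarrow> nat \<Rightarrow> 'e) \<Rightarrow> ennreal \<Rightarrow> real \<Rightarrow> 'x \<Rightarrow> ennreal"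
  where "scale_norm NE L p \<sigma> u = Sigma_norm NE p \<sigma> (L u)"

definition scale_smooth :: "('e \<Rightarrow> real) \<Rightarrow> ((nat \<Rightarrow> 'e) \<Rightarrow> 'x) \<Rightarrow> 'x set"
  where "scale_smooth NE R = R ` (\<Inter>\<sigma>. Sigma_space NE 1 \<sigma>)"

end

theory Submission
  imports Defs
begin

text \<open>
  Fix \<open>v\<close> in the ball and let \<open>x k = 2 powr (k * s) * NE (LX v k)\<close> be its weighted frequencies. The
  point of the proof is that, for all large \<open>n\<close>, the weighted frequency of \<open>\<Phi> v\<close> at \<open>n\<close> satisfies

    \<open>2 powr (n * s) * NF (LY (\<Phi> v) n) \<le> C * (\<Sum>k. 2 powr (- \<delta> * \<bar>n - k\<bar>) * x k)\<close>

  with \<open>\<delta> = min (s - s\<^sub>0) (s\<^sub>1 - s)\<close>. To see it, let \<open>v' = trunc n v\<close> be the image under \<open>RX\<close> of the sequence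
  \<open>LX v\<close> cut off at \<open>n\<close>, and split \<open>\<Phi> v\<close> into \<open>\<Phi> v - \<Phi> v'\<close> and \<open>\<Phi> v'\<close>. The contraction property
  bounds the first part by the frequencies \<open>k \<ge> n\<close> of \<open>v\<close> with the weights of index \<open>s\<^sub>0 < s\<close>, which,
  relative to those of index \<open>s\<close>, decay as \<open>k\<close> grows; the tame estimate, applicable because \<open>v'\<close> is smooth, bounds the second part by
  the frequencies \<open>k < n\<close> with the weights of index \<open>s\<^sub>1 > s\<close>, which, in the same sense,
  decay as \<open>k\<close> decreases. Both estimates are evaluated at the single frequency \<open>n\<close> at which \<open>v\<close> is cut off
  (\<open>pointwise_bound\<close>).

  The kernel \<open>2 powr (- \<delta> * \<bar>n - k\<bar>)\<close> has bounded row and column sums. By the Schur test it maps \<open>\<ell>\<^sup>q\<close>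
  to itself (\<open>lq_bound_decay_sum\<close>), and it also preserves null sequences
  (\<open>lq_vanishing_decay_sum\<close>). So \<open>LY (\<Phi> v)\<close> lies in \<open>Sigma_space NF q s\<close> and \<open>\<Phi> v = RY (LY (\<Phi> v))\<close> lies in \<open>Y s\<close>.

  For the continuity at \<open>v\<close>, the same bound for a nearby \<open>w\<close> controls the high frequencies of
  \<open>\<Phi> w - \<Phi> v\<close> by a tail of the kernel sum for \<open>v\<close>, which is small, and by the kernel sum for \<open>w - v\<close>,
  whose norm is at most a multiple of \<open>NX s (w - v)\<close>. On each of the finitely many remaining
  frequencies the contraction property makes \<open>\<Phi>\<close> Lipschitz (\<open>continuity_estimate\<close>).
\<close>

section \<open>Bounds in weighted sequence spaces\<close>

text \<open>
  \<open>lq_bound q x c\<close> says that the \<open>\<ell>\<^sup>q\<close> norm of the nonnegative sequence \<open>x\<close> is at most \<open>c\<close>.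
  A bound on all partial sums avoids infinite values and summability premises, and it passes
  to pointwise limits of sequences directly.
\<close>

definition lq_bound :: "ennreal \<Rightarrow> (nat \<Rightarrow> real) \<Rightarrow> real \<Rightarrow> bool"
  where "lq_bound q x c \<longleftrightarrow> 0 \<le> c \<and>
    (if q = top then \<forall>k. x k \<le> c
     else \<forall>n. (\<Sum>k<n. x k powr enn2real q) \<le> c powr enn2real q)"

text \<open>
  Small tails describe \<open>\<ell>\<^sup>q\<close> for finite \<open>q\<close> and the null sequences for \<open>q = top\<close>; with this notion the
  two kinds of sequence spaces need no case distinction.
\<close>

definition lq_vanishing :: "ennreal \<Rightarrow> (nat \<Rightarrow> real) \<Rightarrow> bool"
  where "lq_vanishing q x \<longleftrightarrow> (\<forall>\<epsilon>>0. \<exists>M. lq_bound q (\<lambda>k. if k < M then 0 else x k) \<epsilon>)"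

lemma enn2real_ge_1: "1 \<le> q \<Longrightarrow> q \<noteq> top \<Longrightarrow> 1 \<le> enn2real q"
  by (metis enn2real_mono enn2real_1 top.not_eq_extremum)

lemma lq_bound_nonneg: "lq_bound q x c \<Longrightarrow> 0 \<le> c"
  by (simp add: lq_bound_def)

lemma lq_bound_mono:
  assumes "lq_bound q y c" "\<And>k. 0 \<le> x k" "\<And>k. x k \<le> y k" "c \<le> d" "1 \<le> q"
  shows "lq_bound q x d"
proof (cases "q = top")
  case True
  then show ?thesis using assms by (force simp: lq_bound_def intro: order_trans)
next
  case False
  let ?p = "enn2real q"
  have p: "1 \<le> ?p" using enn2real_ge_1 assms False by blast
  have "(\<Sum>k<n. x k powr ?p) \<le> d powr ?p" for n
  proof -
    have "(\<Sum>k<n. x k powr ?p) \<le> (\<Sum>k<n. y k powr ?p)"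
      using assms p by (intro sum_mono powr_mono2) auto
    also have "\<dots> \<le> c powr ?p" using assms False by (simp add: lq_bound_def)
    also have "\<dots> \<le> d powr ?p" using assms p by (intro powr_mono2) (auto simp: lq_bound_def)
    finally show ?thesis .
  qed
  then show ?thesis using False assms by (simp add: lq_bound_def)
qed

lemma lq_bound_coord:
  assumes "lq_bound q x c" "\<And>k. 0 \<le> x k" "1 \<le> q"
  shows "x k \<le> c"
proof (cases "q = top")
  case False
  let ?p = "enn2real q"
  have p: "1 \<le> ?p" using enn2real_ge_1 assms False by blast
  have "x k powr ?p \<le> (\<Sum>j<Suc k. x j powr ?p)"
    by (rule member_le_sum) auto
  also have "\<dots> \<le> c powr ?p" using assms False by (simp add: lq_bound_def del: sum.lessThan_Suc)
  finally have "x k powr ?p \<le> c powr ?p" .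
  then show ?thesis
    using p assms powr_less_mono2[of ?p c "x k"] by (force simp: lq_bound_def)
qed (use assms in \<open>simp add: lq_bound_def\<close>)

lemma lq_bound_cmult:
  assumes "lq_bound q x c" "0 \<le> b" "\<And>k. 0 \<le> x k"
  shows "lq_bound q (\<lambda>k. b * x k) (b * c)"
proof (cases "q = top")
  case False
  have "0 \<le> c" using assms by (simp add: lq_bound_def)
  then show ?thesis using assms False
    by (auto simp: lq_bound_def powr_mult simp flip: sum_distrib_left intro!: mult_left_mono)
qed (use assms in \<open>auto simp: lq_bound_def intro: mult_left_mono\<close>)

text \<open>
  Jensen's inequality for the convex function \<open>t powr p\<close>: divide the weights by their sum. The
  terms with \<open>x k = 0\<close> are dropped first, so that all points lie in the open half line on which
  convexity is available.
\<close>

lemma powr_weighted_sum_le: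
  fixes \<kappa> x :: "'a \<Rightarrow> real"
  assumes A: "finite A" and \<kappa>: "\<And>k. k \<in> A \<Longrightarrow> 0 < \<kappa> k" and x: "\<And>k. k \<in> A \<Longrightarrow> 0 \<le> x k"
    and M: "(\<Sum>k\<in>A. \<kappa> k) \<le> M" and p: "1 \<le> p"
  shows "(\<Sum>k\<in>A. \<kappa> k * x k) powr p \<le> M powr (p - 1) * (\<Sum>k\<in>A. \<kappa> k * x k powr p)"
proof -
  define S where "S = {k\<in>A. 0 < x k}"
  define m where "m = (\<Sum>k\<in>S. \<kappa> k)"
  have S: "finite S" "S \<subseteq> A" using A by (auto simp: S_def)
  have eq: "(\<Sum>k\<in>A. \<kappa> k * x k) = (\<Sum>k\<in>S. \<kappa> k * x k)"
    "(\<Sum>k\<in>A. \<kappa> k * x k powr p) = (\<Sum>k\<in>S. \<kappa> k * x k powr p)"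
    using A x p by (auto intro!: sum.mono_neutral_right simp: S_def less_le)
  show ?thesis
  proof (cases "S = {}")
    case True
    then show ?thesis unfolding eq by simp
  next
    case False
    have m: "0 < m" unfolding m_def using S False \<kappa> by (intro sum_pos) auto
    have mM: "m \<le> M" unfolding m_def
      using S A \<kappa> by (intro order_trans[OF _ M] sum_mono2) (auto intro: less_imp_le)
    have one: "(\<Sum>k\<in>S. \<kappa> k / m) = 1" using m by (simp add: m_def flip: sum_divide_distrib)
    have "(\<Sum>k\<in>S. (\<kappa> k / m) *\<^sub>R x k) powr p \<le> (\<Sum>k\<in>S. (\<kappa> k / m) * x k powr p)"
      using S m False \<kappa> one
      by (intro convex_on_sum[OF _ _ powr_convex[OF p]]) (auto simp: S_def less_imp_le)
    then have J: "(\<Sum>k\<in>S. \<kappa> k * x k / m) powr p \<le> (\<Sum>k\<in>S. \<kappa> k * x k powr p / m)"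
      by simp
    have nn: "0 \<le> (\<Sum>k\<in>S. \<kappa> k * x k)"
      using \<kappa> S by (intro sum_nonneg mult_nonneg_nonneg) (auto simp: S_def less_imp_le)
    have nn': "0 \<le> (\<Sum>k\<in>S. \<kappa> k * x k powr p)"
      using \<kappa> S by (intro sum_nonneg mult_nonneg_nonneg) (auto simp: S_def less_imp_le)
    have "(\<Sum>k\<in>S. \<kappa> k * x k) powr p = m powr p * (\<Sum>k\<in>S. \<kappa> k * x k / m) powr p"
      using m nn by (simp add: powr_divide flip: sum_divide_distrib)
    also have "\<dots> \<le> m powr p * (\<Sum>k\<in>S. \<kappa> k * x k powr p / m)"
      using J by (rule mult_left_mono) auto
    also have "\<dots> = m powr (p - 1) * (\<Sum>k\<in>S. \<kappa> k * x k powr p)"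
      using m by (simp add: powr_diff flip: sum_divide_distrib)
    also have "\<dots> \<le> M powr (p - 1) * (\<Sum>k\<in>S. \<kappa> k * x k powr p)"
      using m mM p nn' by (intro mult_right_mono powr_mono2) auto
    finally show ?thesis unfolding eq .
  qed
qed

text \<open>
  A triangle inequality with a factor that is not optimal. Every estimate below allows a
  constant, so the convexity bound \<open>(x + y) powr p \<le> 2 powr (p - 1) * (x powr p + y powr p)\<close> suffices
  in place of Minkowski's inequality.
\<close>

lemma lq_bound_add:
  assumes x: "lq_bound q x c" and y: "lq_bound q y c" and q: "1 \<le> q"
    and nn: "\<And>k. 0 \<le> x k" "\<And>k. 0 \<le> y k"
  shows "lq_bound q (\<lambda>k. x k + y k) (2 * c)"
proof (cases "q = top")
  case True
  have "x k + y k \<le> 2 * c" for k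
    using x y True add_mono[of "x k" c "y k" c] by (simp add: lq_bound_def)
  then show ?thesis using x True by (simp add: lq_bound_def)
next
  case False
  let ?p = "enn2real q"
  have p: "1 \<le> ?p" using enn2real_ge_1 q False by blast
  have c: "0 \<le> c" using x by (simp add: lq_bound_def)
  have "(\<Sum>k<n. (x k + y k) powr ?p) \<le> (2 * c) powr ?p" for n
  proof -
    have "(x k + y k) powr ?p \<le> 2 powr (?p - 1) * (x k powr ?p + y k powr ?p)" for k
      using powr_weighted_sum_le[of "UNIV :: bool set" "\<lambda>_. 1" "\<lambda>b. if b then x k else y k" 2 ?p] p nn
      by (simp add: UNIV_bool algebra_simps)
    then have "(\<Sum>k<n. (x k + y k) powr ?p) \<le> (\<Sum>k<n. 2 powr (?p - 1) * (x k powr ?p + y k powr ?p))"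
      by (intro sum_mono)
    also have "\<dots> = 2 powr (?p - 1) * ((\<Sum>k<n. x k powr ?p) + (\<Sum>k<n. y k powr ?p))"
      by (simp add: sum.distrib flip: sum_distrib_left)
    also have "\<dots> \<le> 2 powr (?p - 1) * (c powr ?p + c powr ?p)"
      using x y False by (intro mult_left_mono add_mono) (auto simp: lq_bound_def)
    also have "\<dots> = (2 * c) powr ?p" using c by (simp add: powr_mult powr_diff)
    finally show ?thesis .
  qed
  then show ?thesis using c False by (simp add: lq_bound_def)
qed

lemma lq_bound_single:
  assumes "1 \<le> q"
  shows "lq_bound q (\<lambda>k. if k = n then 1 else 0) 1"
proof (cases "q = top")
  case False
  have "(\<Sum>k<m. (if k = n then 1 else 0) powr enn2real q) = (\<Sum>k<m. if k = n then 1 else 0)" for m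
    by (intro sum.cong) auto
  then show ?thesis using False by (simp add: lq_bound_def)
qed (simp add: lq_bound_def)

lemma lq_bound_head:
  assumes q: "1 \<le> q" and b: "0 \<le> b"
  shows "lq_bound q (\<lambda>k. if k < n then b else 0) (real n * b)"
proof (cases "q = top")
  case True
  have "b \<le> real n * b" if "k < n" for k
    using that b mult_right_mono[of 1 "real n" b] by simp
  then show ?thesis using True b by (auto simp: lq_bound_def)
next
  case False
  let ?p = "enn2real q"
  have p: "1 \<le> ?p" using enn2real_ge_1 q False by blast
  have "(\<Sum>k<m. (if k < n then b else 0) powr ?p) \<le> (real n * b) powr ?p" for m
  proof (cases "n = 0")
    case False
    have "(\<Sum>k<m. (if k < n then b else 0) powr ?p) = (\<Sum>k\<in>{..<m} \<inter> {..<n}. b powr ?p)"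
      by (intro sum.mono_neutral_cong_right) (auto split: if_splits)
    also have "\<dots> \<le> (\<Sum>k<n. b powr ?p)" by (intro sum_mono2) auto
    also have "\<dots> = real n powr 1 * b powr ?p" by simp
    also have "\<dots> \<le> real n powr ?p * b powr ?p"
      using p False by (intro mult_right_mono powr_mono) auto
    also have "\<dots> = (real n * b) powr ?p" using b by (simp add: powr_mult)
    finally show ?thesis .
  qed simp
  then show ?thesis using False b by (simp add: lq_bound_def)
qed

section \<open>Summation against an exponentially decaying kernel\<close>

definition decay_kernel :: "real \<Rightarrow> nat \<Rightarrow> nat \<Rightarrow> real"
  where "decay_kernel \<delta> n k = 2 powr (- \<delta> * \<bar>real n - real k\<bar>)"

definition decay_sum :: "real \<Rightarrow> (nat \<Rightarrow> real) \<Rightarrow> nat \<Rightarrow> real"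
  where "decay_sum \<delta> x n = (\<Sum>k. decay_kernel \<delta> n k * x k)"

lemma decay_kernel_pos: "0 < decay_kernel \<delta> n k"
  by (simp add: decay_kernel_def)

lemma decay_kernel_nonneg: "0 \<le> decay_kernel \<delta> n k"
  by (simp add: decay_kernel_def)

lemma decay_kernel_sym: "decay_kernel \<delta> n k = decay_kernel \<delta> k n"
  by (simp add: decay_kernel_def abs_minus_commute)

text \<open>
  Two geometric series of ratio \<open>2 powr (-\<delta>)\<close>, one on each side of the diagonal; each counts the
  diagonal term.
\<close>

lemma decay_kernel_sum_le:
  assumes "0 < \<delta>"
  shows "(\<Sum>k<J. decay_kernel \<delta> n k) \<le> 2 / (1 - 2 powr - \<delta>)"
proof -
  define \<rho> :: real where "\<rho> = 2 powr - \<delta>"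
  have \<rho>: "0 < \<rho>" "\<rho> < 1" using assms powr_less_one[of 2 "-\<delta>"] by (simp_all add: \<rho>_def)
  have \<rho>_pow: "2 powr (- \<delta> * real j) = \<rho> ^ j" for j
    by (simp add: \<rho>_def powr_powr flip: powr_realpow)
  have "(\<Sum>k<J. decay_kernel \<delta> n k) \<le> (\<Sum>k\<in>{..<Suc n} \<union> {n..<n+J}. decay_kernel \<delta> n k)"
    by (intro sum_mono2) (auto intro: less_imp_le decay_kernel_pos)
  also have "\<dots> \<le> (\<Sum>k<Suc n. decay_kernel \<delta> n k) + (\<Sum>k=n..<n+J. decay_kernel \<delta> n k)"
    by (subst sum_Un) (auto intro!: sum_nonneg decay_kernel_nonneg)
  also have "(\<Sum>k<Suc n. decay_kernel \<delta> n k) = (\<Sum>j<Suc n. \<rho> ^ j)"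
    unfolding decay_kernel_def
    by (subst sum.nat_diff_reindex[symmetric]) (auto intro!: sum.cong simp flip: \<rho>_pow)
  also have "(\<Sum>k=n..<n+J. decay_kernel \<delta> n k) = (\<Sum>j<J. \<rho> ^ j)"
    unfolding decay_kernel_def
    by (rule sum.reindex_bij_witness[of _ "\<lambda>j. n + j" "\<lambda>k. k - n"]) (auto simp flip: \<rho>_pow)
  finally have "(\<Sum>k<J. decay_kernel \<delta> n k) \<le> (\<Sum>j<Suc n. \<rho> ^ j) + (\<Sum>j<J. \<rho> ^ j)" .
  also have "\<dots> \<le> 1 / (1 - \<rho>) + 1 / (1 - \<rho>)"
    using \<rho> by (intro add_mono less_imp_le geometric_sum_less) auto
  finally show ?thesis by (simp add: \<rho>_def)
qed

lemma decay_kernel_summable: "0 < \<delta> \<Longrightarrow> summable (decay_kernel \<delta> n)"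
  using decay_kernel_sum_le[of \<delta> n] decay_kernel_nonneg by (intro summableI_nonneg_bounded)

lemma decay_summable:
  assumes "0 < \<delta>" "lq_bound q x c" "\<And>k. 0 \<le> x k" "1 \<le> q"
  shows "summable (\<lambda>k. decay_kernel \<delta> n k * x k)"
proof (rule summable_comparison_test')
  show "summable (\<lambda>k. decay_kernel \<delta> n k * c)"
    using decay_kernel_summable assms by (intro summable_mult2)
  show "norm (decay_kernel \<delta> n k * x k) \<le> decay_kernel \<delta> n k * c" for k
    using assms decay_kernel_pos[of \<delta> n k] lq_bound_coord[OF assms(2-4)] by (simp add: abs_mult)
qed

lemma decay_sum_nonneg:
  assumes "0 < \<delta>" "lq_bound q x c" "\<And>k. 0 \<le> x k" "1 \<le> q"
  shows "0 \<le> decay_sum \<delta> x n"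
  unfolding decay_sum_def
  using assms decay_kernel_nonneg by (intro suminf_nonneg decay_summable[OF assms]) auto

lemma decay_sum_le_add:
  assumes "0 < \<delta>" "1 \<le> q" "lq_bound q y c" "lq_bound q z d"
    and "\<And>k. 0 \<le> x k" "\<And>k. 0 \<le> y k" "\<And>k. 0 \<le> z k" and le: "\<And>k. x k \<le> y k + z k"
  shows "decay_sum \<delta> x n \<le> decay_sum \<delta> y n + decay_sum \<delta> z n"
proof -
  note sy = decay_summable[OF assms(1,3,6,2), of n] and sz = decay_summable[OF assms(1,4,7,2), of n]
  have step: "decay_kernel \<delta> n k * x k \<le> decay_kernel \<delta> n k * y k + decay_kernel \<delta> n k * z k" for k
    using mult_left_mono[OF le, of "decay_kernel \<delta> n k" k] decay_kernel_pos[of \<delta> n k]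
    by (simp add: algebra_simps)
  have "summable (\<lambda>k. decay_kernel \<delta> n k * x k)"
    using step assms(5) decay_kernel_nonneg[of \<delta> n]
    by (intro summable_comparison_test'[OF summable_add[OF sy sz]]) (auto simp: abs_mult)
  then show ?thesis
    unfolding decay_sum_def suminf_add[OF sy sz]
    using step summable_add[OF sy sz] by (intro suminf_le)
qed

text \<open>
  The Schur test. The kernel has row and column sums at most \<open>M\<close>. Jensen's inequality in each row
  bounds the \<open>p\<close>-th power of a row by \<open>M powr (p - 1)\<close> times the kernel sum of the \<open>p\<close>-th powers,
  and after exchanging the two sums the columns contribute one more factor \<open>M\<close>. The argument is
  run on the partial sums \<open>P J\<close> of the rows; the bound survives the limit \<open>J \<longlongrightarrow> \<infinity>\<close>.
\<close>

lemma lq_bound_decay_sum: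
  assumes \<delta>: "0 < \<delta>" and x: "lq_bound q x c" "\<And>k. 0 \<le> x k" and q: "1 \<le> q"
  shows "lq_bound q (decay_sum \<delta> x) (2 / (1 - 2 powr - \<delta>) * c)"
proof -
  define M :: real where "M = 2 / (1 - 2 powr - \<delta>)"
  have M: "0 < M" using \<delta> powr_less_one[of 2 "-\<delta>"] by (simp add: M_def)
  have row: "(\<Sum>k<J. decay_kernel \<delta> n k) \<le> M" for n J
    unfolding M_def by (rule decay_kernel_sum_le[OF \<delta>])
  have c: "0 \<le> c" using x by (simp add: lq_bound_def)
  have pos: "0 \<le> decay_kernel \<delta> n k" for n k using decay_kernel_pos[of \<delta> n k] by simp
  define P where "P J n = (\<Sum>k<J. decay_kernel \<delta> n k * x k)" for J n
  have lim: "(\<lambda>J. P J n) \<longlonglongrightarrow> decay_sum \<delta> x n" for n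
    unfolding P_def decay_sum_def using decay_summable[OF \<delta> x q] by (rule summable_LIMSEQ)
  show ?thesis
  proof (cases "q = top")
    case True
    have "P J n \<le> M * c" for J n
    proof -
      have "P J n \<le> (\<Sum>k<J. decay_kernel \<delta> n k * c)" unfolding P_def
        using lq_bound_coord[OF x q] pos by (intro sum_mono mult_left_mono) auto
      also have "\<dots> \<le> M * c" using row[where n=n and J=J] c
        by (simp add: mult_right_mono flip: sum_distrib_right)
      finally show ?thesis .
    qed
    then have "decay_sum \<delta> x n \<le> M * c" for n
      using lim by (intro LIMSEQ_le_const2[OF lim]) auto
    then show ?thesis using True M c by (simp add: lq_bound_def M_def)
  next
    case False
    let ?p = "enn2real q"
    have p: "1 \<le> ?p" using enn2real_ge_1 q False by blast
    have le: "(\<Sum>n<m. P J n powr ?p) \<le> (M * c) powr ?p" for J m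
    proof -
      have "(\<Sum>n<m. P J n powr ?p)
          \<le> (\<Sum>n<m. M powr (?p - 1) * (\<Sum>k<J. decay_kernel \<delta> n k * x k powr ?p))"
        unfolding P_def using x p row decay_kernel_pos
        by (intro sum_mono powr_weighted_sum_le) auto
      also have "\<dots> = M powr (?p - 1) * (\<Sum>k<J. (\<Sum>n<m. decay_kernel \<delta> k n) * x k powr ?p)"
        unfolding sum_distrib_left sum_distrib_right
        by (subst sum.swap) (simp add: decay_kernel_sym)
      also have "\<dots> \<le> M powr (?p - 1) * (\<Sum>k<J. M * x k powr ?p)"
        using row by (intro mult_left_mono sum_mono mult_right_mono) auto
      also have "\<dots> \<le> M powr (?p - 1) * (M * c powr ?p)"
        using x False M unfolding sum_distrib_left[symmetric]
        by (intro mult_left_mono) (auto simp: lq_bound_def)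
      also have "\<dots> = (M * c) powr ?p" using M c by (simp add: powr_mult powr_diff)
      finally show ?thesis .
    qed
    have tends: "(\<lambda>J. \<Sum>n<m. P J n powr ?p) \<longlonglongrightarrow> (\<Sum>n<m. decay_sum \<delta> x n powr ?p)" for m
      using p x pos by (intro tendsto_sum tendsto_powr' lim tendsto_const)
        (auto intro!: always_eventually sum_nonneg simp: P_def)
    have "(\<Sum>n<m. decay_sum \<delta> x n powr ?p) \<le> (M * c) powr ?p" for m
      by (rule LIMSEQ_le_const2[OF tends]) (use le in auto)
    then show ?thesis using False M c by (simp add: lq_bound_def M_def)
  qed
qed

text \<open>
  A sequence with small tails is the sum of such a tail, of norm at most 1, and finitely many
  terms.
\<close>

lemma lq_vanishing_bounded:
  assumes "lq_vanishing q x" and nn: "\<And>k. 0 \<le> x k" and q: "1 \<le> q"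
  obtains c where "lq_bound q x c"
proof -
  obtain M where M: "lq_bound q (\<lambda>k. if k < M then 0 else x k) 1"
    using assms by (auto simp: lq_vanishing_def dest: spec[of _ 1])
  define b where "b = (\<Sum>k<M. x k)"
  define c where "c = max 1 (real M * b)"
  have b: "x k \<le> b" if "k < M" for k
    unfolding b_def using nn that by (intro member_le_sum) auto
  have b0: "0 \<le> b" unfolding b_def using nn by (intro sum_nonneg)
  have "lq_bound q (\<lambda>k. if k < M then b else 0) c"
    using b0 by (intro lq_bound_mono[OF lq_bound_head[OF q b0]]) (auto simp: c_def q)
  moreover have "lq_bound q (\<lambda>k. if k < M then 0 else x k) c"
    using nn by (intro lq_bound_mono[OF M]) (auto simp: c_def q)
  ultimately have "lq_bound q (\<lambda>k. (if k < M then b else 0) + (if k < M then 0 else x k)) (2 * c)"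
    using b0 nn q by (intro lq_bound_add) auto
  then have "lq_bound q x (2 * c)"
    using nn b by (elim lq_bound_mono[OF _ _ _ order_refl q]) auto
  then show thesis by (rule that)
qed

lemma lq_vanishing_dominated:
  assumes "lq_vanishing q y" and nn: "\<And>k. 0 \<le> x k" "\<And>k. 0 \<le> y k"
    and le: "\<And>k. n \<le> k \<Longrightarrow> x k \<le> C * y k" and C: "0 \<le> C" and q: "1 \<le> q"
  shows "lq_vanishing q x"
  unfolding lq_vanishing_def
proof (intro allI impI)
  fix \<epsilon> :: real assume "0 < \<epsilon>"
  then have "0 < \<epsilon> / (C + 1)" using C by simp
  then obtain M where M: "lq_bound q (\<lambda>k. if k < M then 0 else y k) (\<epsilon> / (C + 1))"
    using assms(1) unfolding lq_vanishing_def by blast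
  have "lq_bound q (\<lambda>k. (C + 1) * (if k < M then 0 else y k)) ((C + 1) * (\<epsilon> / (C + 1)))"
    using C nn by (intro lq_bound_cmult[OF M]) auto
  then have "lq_bound q (\<lambda>k. (C + 1) * (if k < M then 0 else y k)) \<epsilon>" using C by simp
  moreover have "x k \<le> (C + 1) * y k" if "n \<le> k" for k
    using le[OF that] nn(2)[of k] by (simp add: algebra_simps)
  ultimately have "lq_bound q (\<lambda>k. if k < max n M then 0 else x k) \<epsilon>"
    using nn C by (rule_tac lq_bound_mono[OF _ _ _ order_refl q]) auto
  then show "\<exists>M. lq_bound q (\<lambda>k. if k < M then 0 else x k) \<epsilon>" ..
qed

lemma lq_vanishing_finite_support:
  assumes "\<And>k. n \<le> k \<Longrightarrow> x k = 0" and q: "1 \<le> q"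
  shows "lq_vanishing q x"
proof -
  have "(\<lambda>k. if k < n then 0 else x k) = (\<lambda>k. if k < 0 then 0 else 0)"
    using assms by auto
  then have "lq_bound q (\<lambda>k. if k < n then 0 else x k) \<epsilon>" if "0 < \<epsilon>" for \<epsilon>
    using lq_bound_mono[OF lq_bound_head[OF q, of 0 0]] that q by simp
  then show ?thesis by (auto simp: lq_vanishing_def)
qed

lemma lq_bound_1_iff:
  assumes "\<And>k. 0 \<le> x k"
  shows "lq_bound 1 x c \<longleftrightarrow> 0 \<le> c \<and> (\<forall>n. (\<Sum>k<n. x k) \<le> c)"
  using assms by (auto simp: lq_bound_def)

text \<open>
  Split \<open>x\<close> at a large index \<open>M\<close>. The tail of \<open>x\<close> is small, and so is its kernel sum by the Schur
  test. The kernel sum of the first \<open>M\<close> terms decays exponentially beyond \<open>M\<close>: from index \<open>M + m\<close>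
  on it is at most \<open>\<eta>\<close> times the kernel sum of the unit sequence at \<open>M + m\<close>, whose norm is bounded
  independently of \<open>m\<close>.
\<close>

lemma lq_vanishing_decay_sum:
  assumes \<delta>: "0 < \<delta>" and x: "lq_vanishing q x" "\<And>k. 0 \<le> x k" and q: "1 \<le> q"
  shows "lq_vanishing q (decay_sum \<delta> x)"
  unfolding lq_vanishing_def
proof (intro allI impI)
  fix \<epsilon> :: real assume \<epsilon>: "0 < \<epsilon>"
  define A :: real where "A = 2 / (1 - 2 powr - \<delta>)"
  have A: "0 < A" using \<delta> powr_less_one[of 2 "-\<delta>"] by (simp add: A_def)
  define \<eta> where "\<eta> = \<epsilon> / (2 * A)"
  have \<eta>: "0 < \<eta>" using \<epsilon> A by (simp add: \<eta>_def)
  obtain M where M: "lq_bound q (\<lambda>k. if k < M then 0 else x k) \<eta>" (is "lq_bound q ?t \<eta>")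
    using x \<eta> unfolding lq_vanishing_def by blast
  obtain c where c: "lq_bound q x c" using lq_vanishing_bounded[OF x q] .
  let ?h = "\<lambda>k. if k < M then x k else 0"
  have h: "lq_bound q ?h c" using x by (intro lq_bound_mono[OF c _ _ order_refl q]) auto
  define D where "D = decay_sum \<delta> ?h M"
  have D: "0 \<le> D" unfolding D_def using x q by (intro decay_sum_nonneg[OF \<delta> h]) auto
  have head: "decay_sum \<delta> ?h n = 2 powr (- \<delta> * real (n - M)) * D" if "M \<le> n" for n
  proof -
    have "decay_kernel \<delta> n k * ?h k = 2 powr (- \<delta> * real (n - M)) * (decay_kernel \<delta> M k * ?h k)" for k
      using that by (auto simp: decay_kernel_def algebra_simps of_nat_diff simp flip: powr_add)
    moreover have "summable (\<lambda>k. decay_kernel \<delta> M k * ?h k)"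
      using x q by (intro decay_summable[OF \<delta> h]) auto
    ultimately show ?thesis by (simp only: D_def decay_sum_def suminf_mult)
  qed
  have "(\<lambda>n. 2 powr (- \<delta> * real n) * D) \<longlonglongrightarrow> 0"
  proof -
    have "(\<lambda>n. (2 powr - \<delta>) ^ n * D) \<longlonglongrightarrow> 0 * D"
      using \<delta> powr_less_one[of 2 "-\<delta>"] by (intro tendsto_intros LIMSEQ_power_zero) auto
    then show ?thesis by (simp add: powr_powr flip: powr_realpow)
  qed
  from order_tendstoD(2)[OF this \<eta>] obtain m where m: "2 powr (- \<delta> * real m) * D < \<eta>"
    by (auto simp: eventually_sequentially)
  let ?e = "\<lambda>k. if k = M + m then 1 else 0 :: real"
  have "decay_sum \<delta> ?e n = decay_kernel \<delta> n (M + m)" for n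
    unfolding decay_sum_def by (subst suminf_finite[of "{M + m}"]) auto
  then have "decay_sum \<delta> ?e = (\<lambda>n. decay_kernel \<delta> n (M + m))" by blast
  moreover have "lq_bound q (decay_sum \<delta> ?e) A"
    using lq_bound_decay_sum[OF \<delta> lq_bound_single[OF q, of "M + m"] _ q] by (simp add: A_def)
  ultimately have "lq_bound q (\<lambda>n. decay_kernel \<delta> n (M + m)) A" by simp
  then have "lq_bound q (\<lambda>n. \<eta> * decay_kernel \<delta> n (M + m)) (\<eta> * A)"
    using \<eta> decay_kernel_nonneg by (intro lq_bound_cmult) auto
  moreover have "lq_bound q (decay_sum \<delta> ?t) (A * \<eta>)"
    unfolding A_def using x by (intro lq_bound_decay_sum[OF \<delta> M _ q]) auto
  moreover have tnn: "0 \<le> decay_sum \<delta> ?t n" for n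
    using x by (intro decay_sum_nonneg[OF \<delta> M _ q]) auto
  ultimately have "lq_bound q (\<lambda>n. \<eta> * decay_kernel \<delta> n (M + m) + decay_sum \<delta> ?t n) (2 * (\<eta> * A))"
    using \<eta> q decay_kernel_nonneg by (intro lq_bound_add) (auto simp: mult.commute)
  moreover have "decay_sum \<delta> x n \<le> \<eta> * decay_kernel \<delta> n (M + m) + decay_sum \<delta> ?t n" if "M + m \<le> n" for n
  proof -
    have "decay_sum \<delta> x n \<le> decay_sum \<delta> ?h n + decay_sum \<delta> ?t n"
      using x by (intro decay_sum_le_add[OF \<delta> q h M]) auto
    also have "decay_sum \<delta> ?h n = (2 powr (- \<delta> * real m) * D) * decay_kernel \<delta> n (M + m)"
      using that by (auto simp: head decay_kernel_def of_nat_diff algebra_simps simp flip: powr_add)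
    also have "\<dots> \<le> \<eta> * decay_kernel \<delta> n (M + m)"
      using m decay_kernel_nonneg by (intro mult_right_mono) auto
    finally show ?thesis by simp
  qed
  moreover have "0 \<le> decay_sum \<delta> x n" for n
    using decay_sum_nonneg[OF \<delta> c x(2) q] .
  ultimately have "lq_bound q (\<lambda>n. if n < M + m then 0 else decay_sum \<delta> x n) (2 * (\<eta> * A))"
    using \<eta> tnn decay_kernel_nonneg by (elim lq_bound_mono[OF _ _ _ order_refl q]) auto
  moreover have "2 * (\<eta> * A) = \<epsilon>" using A by (simp add: \<eta>_def)
  ultimately show "\<exists>M. lq_bound q (\<lambda>n. if n < M then 0 else decay_sum \<delta> x n) \<epsilon>" by metis
qed

section \<open>Weighted norms in terms of bounds on sequences\<close>

definition weighted :: "('e \<Rightarrow> real) \<Rightarrow> real \<Rightarrow> (nat \<Rightarrow> 'e) \<Rightarrow> nat \<Rightarrow> real"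
  where "weighted N s f k = 2 powr (real k * s) * N (f k)"

lemma weighted_nonneg: "(\<And>x. 0 \<le> N x) \<Longrightarrow> 0 \<le> weighted N s f k"
  by (simp add: weighted_def)

lemma Sigma_norm_le_iff:
  assumes N: "\<And>x. 0 \<le> N x" and q: "1 \<le> q" and c: "0 \<le> c"
  shows "Sigma_norm N q s f \<le> ennreal c \<longleftrightarrow> lq_bound q (weighted N s f) c"
proof (cases "q = top")
  case True
  then show ?thesis
    using N c by (simp add: Sigma_norm_def lq_bound_def weighted_def SUP_le_iff)
next
  case False
  define p where "p = enn2real q"
  have p: "1 \<le> p" unfolding p_def using enn2real_ge_1 q False by blast
  define y where "y k = weighted N s f k powr p" for k
  define S where "S = (\<Sum>k. ennreal (y k))"
  have y0: "0 \<le> y k" for k by (simp add: y_def)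
  have step: "2 powr (p * real k * s) * N (f k) powr p = y k" for k
    using N by (simp add: y_def weighted_def powr_mult powr_powr mult_ac)
  have norm_eq: "Sigma_norm N q s f = (if S = top then top else ennreal (enn2real S powr (1 / p)))"
    unfolding Sigma_norm_def Let_def p_def[symmetric] step S_def[symmetric] using False by simp
  have Sle: "S \<le> ennreal d \<longleftrightarrow> (\<forall>n. (\<Sum>k<n. y k) \<le> d)" if "0 \<le> d" for d
    using that y0 by (simp add: S_def suminf_eq_SUP SUP_le_iff sum_ennreal)
  have "Sigma_norm N q s f \<le> ennreal c \<longleftrightarrow> S \<le> ennreal (c powr p)"
  proof (cases "S = top")
    case True
    then show ?thesis by (simp add: norm_eq top_unique)
  next
    case fin: False
    then obtain t where t: "S = ennreal t" "0 \<le> t" by (cases S) auto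
    have "t powr (1 / p) \<le> c \<longleftrightarrow> t \<le> c powr p"
    proof
      assume "t powr (1 / p) \<le> c"
      then have "(t powr (1 / p)) powr p \<le> c powr p" using p by (intro powr_mono2) auto
      then show "t \<le> c powr p" using p t by (simp add: powr_powr)
    next
      assume "t \<le> c powr p"
      then have "t powr (1 / p) \<le> (c powr p) powr (1 / p)" using p t by (intro powr_mono2) auto
      then show "t powr (1 / p) \<le> c" using p c by (simp add: powr_powr)
    qed
    then show ?thesis using t c by (simp add: norm_eq ennreal_le_iff)
  qed
  also have "\<dots> \<longleftrightarrow> lq_bound q (weighted N s f) c"
    using False c by (simp add: Sle lq_bound_def y_def p_def)
  finally show ?thesis .
qed

text \<open>
  For finite \<open>q\<close>, a convergent series has small tails, and a sequence with one bounded tail has a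
  finite norm; for \<open>q = top\<close>, the suprema of the tails are small exactly for null sequences.
\<close>

lemma Sigma_space_iff:
  assumes N: "\<And>x. 0 \<le> N x" and q: "1 \<le> q"
  shows "f \<in> Sigma_space N q s \<longleftrightarrow> lq_vanishing q (weighted N s f)"
proof -
  define x where "x = weighted N s f"
  have nn: "0 \<le> x k" for k unfolding x_def using N by (rule weighted_nonneg)
  have "f \<in> Sigma_space N q s \<longleftrightarrow> lq_vanishing q x"
  proof (cases "q = top")
    case True
    have x_eq: "x = (\<lambda>k. 2 powr (real k * s) * N (f k))" by (simp add: x_def weighted_def fun_eq_iff)
    have "lq_vanishing q x \<longleftrightarrow> (\<forall>\<epsilon>>0. \<exists>M. \<forall>k\<ge>M. x k \<le> \<epsilon>)"
      unfolding lq_vanishing_def lq_bound_def using True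
      by (intro all_cong ex_cong) (auto simp: not_less)
    also have "\<dots> \<longleftrightarrow> x \<longlonglongrightarrow> 0"
    proof
      assume *: "\<forall>\<epsilon>>0. \<exists>M. \<forall>k\<ge>M. x k \<le> \<epsilon>"
      show "x \<longlonglongrightarrow> 0"
        unfolding LIMSEQ_iff
      proof (intro allI impI)
        fix \<epsilon> :: real assume "0 < \<epsilon>"
        then obtain M where "\<forall>k\<ge>M. x k \<le> \<epsilon> / 2" using * half_gt_zero by blast
        then show "\<exists>M. \<forall>k\<ge>M. norm (x k - 0) < \<epsilon>" using \<open>0 < \<epsilon>\<close> nn by (intro exI[of _ M]) force
      qed
    next
      assume "x \<longlonglongrightarrow> 0"
      then show "\<forall>\<epsilon>>0. \<exists>M. \<forall>k\<ge>M. x k \<le> \<epsilon>"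
        using nn by (force simp: LIMSEQ_iff intro: less_imp_le)
    qed
    finally show ?thesis 
using True by (simp add: Sigma_space_def flip: x_eq)
  next
    case False
    let ?p = "enn2real q"
    have p: "1 \<le> ?p" using enn2real_ge_1 q False by blast
    have "f \<in> Sigma_space N q s \<longleftrightarrow> (\<exists>c. lq_bound q x c)"
    proof
      assume "f \<in> Sigma_space N q s"
      then have "Sigma_norm N q s f < top" using False by (simp add: Sigma_space_def)
      then obtain c where "0 \<le> c" "Sigma_norm N q s f = ennreal c" by (cases "Sigma_norm N q s f") auto
      then show "\<exists>c. lq_bound q x c"
        using Sigma_norm_le_iff[where N = N and f = f and c = c and s = s, OF N q] by (auto simp: x_def)
    next
      assume "\<exists>c. lq_bound q x c"
      then obtain c where c: "lq_bound q x c" ..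
      then have "Sigma_norm N q s f \<le> ennreal c"
        using Sigma_norm_le_iff[where N = N and f = f and c = c and s = s, OF N q] by (auto simp: x_def lq_bound_nonneg)
      then show "f \<in> Sigma_space N q s"
        using False by (auto simp: Sigma_space_def intro: le_less_trans)
    qed
    also have "\<dots> \<longleftrightarrow> lq_vanishing q x"
    proof
      assume "\<exists>c. lq_bound q x c"
      then obtain c where c: "(\<Sum>k<n. x k powr ?p) \<le> c powr ?p" for n
        using False by (auto simp: lq_bound_def)
      have "summable (\<lambda>k. x k powr ?p)"
        using c by (intro summableI_nonneg_bounded) auto
      then have cauchy: "\<exists>M. \<forall>m\<ge>M. \<forall>n. norm (\<Sum>k=m..<n. x k powr ?p) < e" if "0 < e" for e
        using that by (auto simp: summable_Cauchy)
      show "lq_vanishing q x"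
        unfolding lq_vanishing_def
      proof (intro allI impI)
        fix \<epsilon> :: real assume \<epsilon>: "0 < \<epsilon>"
        then obtain M where M: "norm (\<Sum>k=M..<n. x k powr ?p) < \<epsilon> powr ?p" for n
          using cauchy[of "\<epsilon> powr ?p"] by auto
        have "(\<Sum>k<n. (if k < M then 0 else x k) powr ?p) = (\<Sum>k=M..<n. x k powr ?p)" for n
          by (intro sum.mono_neutral_cong_right) auto
        moreover have "(\<Sum>k=M..<n. x k powr ?p) \<le> \<epsilon> powr ?p" for n
          using M[of n] by simp
        ultimately have "lq_bound q (\<lambda>k. if k < M then 0 else x k) \<epsilon>"
          using False \<epsilon> by (simp add: lq_bound_def)
        then show "\<exists>M. lq_bound q (\<lambda>k. if k < M then 0 else x k) \<epsilon>" ..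
      qed
    qed (use lq_vanishing_bounded nn q in blast)
    finally show ?thesis .
  qed
  then show ?thesis by (simp add: x_def)
qed

text \<open>
  The factor gained or lost when the regularity index is changed at a fixed frequency \<open>n\<close>; the
  interpolation argument balances such factors against each other.
\<close>

lemma weighted_change_exponent:
  "weighted N s f n = 2 powr (real n * (s - \<sigma>)) * weighted N \<sigma> f n"
  by (simp add: weighted_def algebra_simps flip: powr_add)

section \<open>Frequency truncation in a scale\<close>

definition head :: "nat \<Rightarrow> (nat \<Rightarrow> 'e::zero) \<Rightarrow> nat \<Rightarrow> 'e"
  where "head n f k = (if k < n then f k else 0)"

definition tail :: "nat \<Rightarrow> (nat \<Rightarrow> 'e::zero) \<Rightarrow> nat \<Rightarrow> 'e"
  where "tail n f k = (if k < n then 0 else f k)"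

context pseudo_normed_scale
begin

lemma NE_nonneg: "0 \<le> NE x" and NE_zero: "NE 0 = 0" and NE_add: "NE (x + y) \<le> NE x + NE y"
  using E.pnorm_nonneg E.pnorm_eq_0_iff E.pnorm_triangle by auto

abbreviation W :: "real \<Rightarrow> (nat \<Rightarrow> 'e) \<Rightarrow> nat \<Rightarrow> real"
  where "W \<equiv> weighted NE"

lemma W_nonneg: "0 \<le> W s f k"
  by (rule weighted_nonneg[where N = NE, OF NE_nonneg])

lemmas mem_Sigma_space_iff = Sigma_space_iff[where N = NE, OF NE_nonneg]
lemmas Sigma_norm_NE_le_iff = Sigma_norm_le_iff[where N = NE, OF NE_nonneg]

lemma W_add: "W s (\<lambda>k. f k + g k) k \<le> W s f k + W s g k"
  using mult_left_mono[OF NE_add[of "f k" "g k"], of "2 powr (real k * s)"]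
  by (simp add: weighted_def algebra_simps)

lemma W_mono: "NE (g k) \<le> NE (f k) \<Longrightarrow> W s g k \<le> W s f k"
  by (simp add: weighted_def)

text \<open>
  Used both to lower the regularity index and to pass from a sequence to a part of it.
\<close>

lemma Sigma_space_dominated:
  assumes "f \<in> Sigma_space NE q s" "\<And>k. NE (g k) \<le> NE (f k)" "\<sigma> \<le> s"
  shows "g \<in> Sigma_space NE q \<sigma>"
proof -
  have "W \<sigma> g k \<le> 1 * W s f k" for k
    unfolding weighted_def using assms NE_nonneg
    by (simp add: mult_mono mult_left_mono)
  then show ?thesis
    using assms(1) unfolding mem_Sigma_space_iff[OF q_ge_1]
    by (elim lq_vanishing_dominated[where n = 0 and C = 1]) (auto simp: W_nonneg q_ge_1)
qed

lemma head_mem_Sigma_space: "1 \<le> p \<Longrightarrow> head n f \<in> Sigma_space NE p s"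
  unfolding mem_Sigma_space_iff
  by (rule lq_vanishing_finite_support[of n]) (auto simp: weighted_def head_def NE_zero)

lemma L_mem_Sigma_space: "a \<le> s \<Longrightarrow> u \<in> X s \<Longrightarrow> L u \<in> Sigma_space NE q s"
  using L_R_bounds[of s] by blast

lemma W_L_vanishing: "a \<le> s \<Longrightarrow> u \<in> X s \<Longrightarrow> lq_vanishing q (W s (L u))"
  using L_mem_Sigma_space mem_Sigma_space_iff[OF q_ge_1] by blast

lemma NX_nonneg: "a \<le> s \<Longrightarrow> u \<in> X s \<Longrightarrow> 0 \<le> NX s u"
  using pseudo_normed_space.pnorm_nonneg[OF pseudo_normed_X] by blast

lemma NX_add: "a \<le> s \<Longrightarrow> u \<in> X s \<Longrightarrow> v \<in> X s \<Longrightarrow> NX s (u + v) \<le> NX s u + NX s v"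
  using pseudo_normed_space.pnorm_triangle[OF pseudo_normed_X] by blast

lemma NX_minus: "a \<le> s \<Longrightarrow> u \<in> X s \<Longrightarrow> NX s (- u) = NX s u"
  using pseudo_normed_space.pnorm_minus[OF pseudo_normed_X] by blast

lemma X_diff: "a \<le> s \<Longrightarrow> u \<in> X s \<Longrightarrow> v \<in> X s \<Longrightarrow> u - v \<in> X s"
proof -
  assume *: "a \<le> s" "u \<in> X s" "v \<in> X s"
  interpret pseudo_normed_space scaleX "X s" "NX s" by (rule pseudo_normed_X[OF *(1)])
  show ?thesis using * subspace_carrier subspace_diff by blast
qed

lemma L_norm_bound:
  assumes "a \<le> s"
  obtains C where "0 < C" "\<And>u. u \<in> X s \<Longrightarrow> lq_bound q (W s (L u)) (C * NX s u)"
proof -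
  obtain C where "0 < C" "\<And>u. u \<in> X s \<Longrightarrow> Sigma_norm NE q s (L u) \<le> ennreal (C * NX s u)"
    using L_R_bounds[OF assms] by blast
  then show thesis
    using Sigma_norm_NE_le_iff[OF q_ge_1] NX_nonneg[OF assms] by (intro that[of C]) auto
qed

lemma R_norm_bound:
  assumes "a \<le> s"
  obtains C where "0 < C"
    "\<And>f c. f \<in> Sigma_space NE q s \<Longrightarrow> lq_bound q (W s f) c \<Longrightarrow> NX s (R f) \<le> C * c"
proof -
  obtain C where C: "0 < C"
    "\<And>f. f \<in> Sigma_space NE q s \<Longrightarrow> ennreal (NX s (R f)) \<le> ennreal C * Sigma_norm NE q s f"
    using L_R_bounds[OF assms] by blast
  show thesis
  proof (rule that[OF C(1)])
    fix f c assume f: "f \<in> Sigma_space NE q s" and c: "lq_bound q (W s f) c"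
    have "ennreal (NX s (R f)) \<le> ennreal C * Sigma_norm NE q s f" by (rule C(2)[OF f])
    also have "\<dots> \<le> ennreal C * ennreal c"
      using c lq_bound_nonneg[OF c] Sigma_norm_NE_le_iff[OF q_ge_1] by (intro mult_left_mono) auto
    also have "\<dots> = ennreal (C * c)"
      using C lq_bound_nonneg[OF c] by (simp add: ennreal_mult)
    finally show "NX s (R f) \<le> C * c"
      using C lq_bound_nonneg[OF c] by (simp add: ennreal_le_iff)
  qed
qed

text \<open>
  A finite bound on \<open>f\<close> already contains the membership of \<open>f\<close> in \<open>Sigma_space NE 1 s\<close>.
\<close>

lemma LR_l1_bound:
  assumes "a \<le> s"
  obtains C where "0 < C" "\<And>f c. lq_bound 1 (W s f) c \<Longrightarrow> lq_bound 1 (W s (L (R f))) (C * c)"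
proof -
  obtain C where C: "0 < C" "\<And>f. f \<in> Sigma_space NE 1 s \<Longrightarrow>
      Sigma_norm NE 1 s (L (R f)) \<le> ennreal C * Sigma_norm NE 1 s f"
    using LR_bound[OF assms] by blast
  show thesis
  proof (rule that[OF C(1)])
    fix f c assume f: "lq_bound 1 (W s f) c"
    have c: "0 \<le> c" by (rule lq_bound_nonneg[OF f])
    have n: "Sigma_norm NE 1 s f \<le> ennreal c" using f c Sigma_norm_NE_le_iff by auto
    then have "f \<in> Sigma_space NE 1 s" by (auto simp: Sigma_space_def intro: le_less_trans)
    then have "Sigma_norm NE 1 s (L (R f)) \<le> ennreal C * Sigma_norm NE 1 s f" by (rule C(2))
    also have "\<dots> \<le> ennreal C * ennreal c" using n by (intro mult_left_mono) auto
    also have "\<dots> = ennreal (C * c)" using C c by (simp add: ennreal_mult)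
    finally show "lq_bound 1 (W s (L (R f))) (C * c)"
      using C c Sigma_norm_NE_le_iff by auto
  qed
qed

text \<open>
  The smoothing operator of the scale: a sequence of finite support lies in \<open>Sigma_space NE 1 \<sigma>\<close> for
  every \<open>\<sigma>\<close>, so the values are smooth.
\<close>

definition trunc :: "nat \<Rightarrow> 'x \<Rightarrow> 'x"
  where "trunc n u = R (head n (L u))"

lemma trunc_mem: "a \<le> s \<Longrightarrow> trunc n u \<in> X s"
  unfolding trunc_def using L_R_bounds[of s] head_mem_Sigma_space q_ge_1 by blast

lemma trunc_smooth: "trunc n u \<in> scale_smooth NE R"
  unfolding trunc_def scale_smooth_def using head_mem_Sigma_space by blast

lemma L_diff:
  assumes "u \<in> X a" "v \<in> X a"
  shows "L u k = L (u - v) k + L v k"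
  using L_add[of "u - v" v] X_diff[of a u v] assms by simp

text \<open>
  Together with \<open>trunc_bound\<close> this makes \<open>trunc n w\<close> close to \<open>trunc n v\<close>, uniformly in \<open>n\<close>, when \<open>w\<close>
  is close to \<open>v\<close>.
\<close>

lemma trunc_add:
  assumes "u \<in> X a" "v \<in> X a"
  shows "trunc n (u + v) = trunc n u + trunc n v"
proof -
  have "head n (L (u + v)) = (\<lambda>k. head n (L u) k + head n (L v) k)"
    using L_add[OF assms] by (auto simp: head_def)
  then show ?thesis
    unfolding trunc_def by (simp add: R_add head_mem_Sigma_space q_ge_1)
qed

lemma diff_trunc:
  assumes "u \<in> X a"
  shows "u - trunc n u = R (tail n (L u))"
proof -
  have "L u = (\<lambda>k. head n (L u) k + tail n (L u) k)"
    by (auto simp: head_def tail_def)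
  moreover have "tail n (L u) \<in> Sigma_space NE q a"
    using L_mem[OF assms] by (rule Sigma_space_dominated) (auto simp: tail_def NE_zero NE_nonneg)
  ultimately have "R (L u) = R (head n (L u)) + R (tail n (L u))"
    using R_add[OF head_mem_Sigma_space[OF q_ge_1]] by metis
  then show ?thesis using R_L[OF assms] by (simp add: trunc_def algebra_simps)
qed

lemma trunc_bound:
  assumes s: "a \<le> s"
  obtains C where "0 < C" "\<And>u n. u \<in> X s \<Longrightarrow> NX s (trunc n u) \<le> C * NX s u"
proof -
  obtain C where C: "0 < C" "\<And>u. u \<in> X s \<Longrightarrow> lq_bound q (W s (L u)) (C * NX s u)"
    using L_norm_bound[OF s] by blast
  obtain D where D: "0 < D"
    "\<And>f c. f \<in> Sigma_space NE q s \<Longrightarrow> lq_bound q (W s f) c \<Longrightarrow> NX s (R f) \<le> D * c"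
    using R_norm_bound[OF s] by blast
  show thesis
  proof (rule that[of "D * C"])
    fix u n assume "u \<in> X s"
    then have "lq_bound q (W s (head n (L u))) (C * NX s u)"
      using C(2) by (intro lq_bound_mono[OF C(2)])
        (auto simp: W_nonneg q_ge_1 head_def NE_zero NE_nonneg intro!: W_mono)
    then show "NX s (trunc n u) \<le> D * C * NX s u"
      using D(2)[OF head_mem_Sigma_space[OF q_ge_1]] by (simp add: trunc_def mult.assoc)
  qed (use C D in simp)
qed

text \<open>
  The remainder \<open>u - trunc n u\<close> is the image under \<open>R\<close> of a tail of \<open>L u\<close>. This is where it matters that
  the sequence space for \<open>q = top\<close> consists of weighted null sequences only.
\<close>

lemma trunc_tendsto:
  assumes s: "a \<le> s" and u: "u \<in> X s" and \<epsilon>: "0 < \<epsilon>"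
  obtains M where "\<And>n. M \<le> n \<Longrightarrow> NX s (u - trunc n u) \<le> \<epsilon>"
proof -
  obtain D where D: "0 < D"
    "\<And>f c. f \<in> Sigma_space NE q s \<Longrightarrow> lq_bound q (W s f) c \<Longrightarrow> NX s (R f) \<le> D * c"
    using R_norm_bound[OF s] by blast
  have "0 < \<epsilon> / D" using \<epsilon> D by simp
  then obtain M where M: "lq_bound q (\<lambda>k. if k < M then 0 else W s (L u) k) (\<epsilon> / D)"
    using W_L_vanishing[OF s u] unfolding lq_vanishing_def by blast
  show thesis
  proof (rule that[of M])
    fix n assume "M \<le> n"
    then have "lq_bound q (W s (tail n (L u))) (\<epsilon> / D)"
      by (intro lq_bound_mono[OF M _ _ order_refl q_ge_1])
        (auto simp: W_nonneg weighted_def tail_def NE_zero NE_nonneg)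
    moreover have "tail n (L u) \<in> Sigma_space NE q s"
      using L_mem_Sigma_space[OF s u]
      by (rule Sigma_space_dominated) (auto simp: tail_def NE_zero NE_nonneg)
    ultimately have "NX s (R (tail n (L u))) \<le> D * (\<epsilon> / D)" by (rule D(2)[rotated])
    moreover have "u \<in> X a" using X_decreasing[of a s] s u by auto
    ultimately show "NX s (u - trunc n u) \<le> \<epsilon>" using D by (simp add: diff_trunc)
  qed
qed

text \<open>
  The common core of the two truncation estimates below. Passing from the weight of index \<open>s\<close> to
  that of index \<open>\<sigma>\<close> multiplies the \<open>k\<close>-th term by \<open>2 powr (k * (\<sigma> - s))\<close>. Relative to the value of this
  factor at \<open>n\<close> there is exponential decay away from \<open>n\<close> on one side of \<open>n\<close>: below \<open>n\<close> if \<open>\<sigma> > s\<close>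
  and above \<open>n\<close> if \<open>\<sigma> < s\<close>. The premise \<open>supp\<close> requires \<open>g\<close> to live on that side and
  \<open>\<sigma>\<close> to differ from \<open>s\<close> by at least \<open>\<delta>\<close>.
\<close>

lemma l1_bound_decay_sum:
  assumes \<delta>: "0 < \<delta>" and f: "lq_bound q (W s f) c" and g: "\<And>k. NE (g k) \<le> NE (f k)"
    and supp: "\<And>k. g k \<noteq> 0 \<Longrightarrow> (real k - real n) * (\<sigma> - s) \<le> - \<delta> * \<bar>real n - real k\<bar>"
  shows "lq_bound 1 (W \<sigma> g) (2 powr (real n * (\<sigma> - s)) * decay_sum \<delta> (W s f) n)"
proof -
  let ?b = "2 powr (real n * (\<sigma> - s))"
  have step: "W \<sigma> g k \<le> ?b * (decay_kernel \<delta> n k * W s f k)" for k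
  proof (cases "g k = 0")
    case True
    then show ?thesis using W_nonneg decay_kernel_nonneg by (simp add: weighted_def NE_zero)
  next
    case False
    have "W \<sigma> g k = 2 powr (real k * (\<sigma> - s)) * W s g k"
      by (rule weighted_change_exponent)
    also have "\<dots> = ?b * (2 powr ((real k - real n) * (\<sigma> - s)) * W s g k)"
      by (simp add: algebra_simps flip: powr_add)
    also have "\<dots> \<le> ?b * (decay_kernel \<delta> n k * W s f k)"
    proof (intro mult_left_mono mult_mono)
      show "2 powr ((real k - real n) * (\<sigma> - s)) \<le> decay_kernel \<delta> n k"
        unfolding decay_kernel_def using supp[OF False] by (rule powr_mono) simp
    qed (auto intro: W_mono g W_nonneg decay_kernel_nonneg)
    finally show ?thesis .
  qed
  have sm: "summable (\<lambda>k. decay_kernel \<delta> n k * W s f k)"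
    using decay_summable[OF \<delta> f W_nonneg q_ge_1] .
  have "(\<Sum>k<m. W \<sigma> g k) \<le> ?b * decay_sum \<delta> (W s f) n" for m
  proof -
    have "(\<Sum>k<m. W \<sigma> g k) \<le> (\<Sum>k<m. ?b * (decay_kernel \<delta> n k * W s f k))"
      by (intro sum_mono step)
    also have "\<dots> = ?b * (\<Sum>k<m. decay_kernel \<delta> n k * W s f k)"
      by (simp add: sum_distrib_left)
    also have "\<dots> \<le> ?b * decay_sum \<delta> (W s f) n"
      unfolding decay_sum_def using W_nonneg decay_kernel_nonneg
      by (intro mult_left_mono sum_le_suminf sm) auto
    finally show ?thesis .
  qed
  then show ?thesis
    using decay_sum_nonneg[OF \<delta> f W_nonneg q_ge_1] by (simp add: lq_bound_1_iff W_nonneg)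
qed

lemma W_L_bounded:
  assumes "a \<le> s" "u \<in> X s"
  obtains c where "lq_bound q (W s (L u)) c"
  using L_norm_bound assms by metis

text \<open>
  Low frequencies, measured in an index above \<open>s\<close>.
\<close>

lemma trunc_l1_bound:
  assumes \<sigma>: "a \<le> s" "s + \<delta> \<le> \<sigma>" and \<delta>: "0 < \<delta>"
  obtains C where "0 < C" "\<And>u n. u \<in> X s \<Longrightarrow>
    lq_bound 1 (W \<sigma> (L (trunc n u))) (C * (2 powr (real n * (\<sigma> - s)) * decay_sum \<delta> (W s (L u)) n))"
proof -
  obtain C where C: "0 < C" "\<And>f c. lq_bound 1 (W \<sigma> f) c \<Longrightarrow> lq_bound 1 (W \<sigma> (L (R f))) (C * c)"
    using LR_l1_bound[of \<sigma>] assms by auto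
  show thesis
  proof (rule that[OF C(1)])
    fix u n assume "u \<in> X s"
    then obtain c where c: "lq_bound q (W s (L u)) c" using W_L_bounded \<sigma> by blast
    have "(real k - real n) * (\<sigma> - s) \<le> - \<delta> * \<bar>real n - real k\<bar>" if "k < n" for k
      using mult_left_mono[of \<delta> "\<sigma> - s" "real n - real k"] \<sigma> that by (simp add: algebra_simps)
    then have "lq_bound 1 (W \<sigma> (head n (L u)))
        (2 powr (real n * (\<sigma> - s)) * decay_sum \<delta> (W s (L u)) n)"
      by (intro l1_bound_decay_sum[OF \<delta> c]) (auto simp: head_def NE_zero NE_nonneg split: if_splits)
    then show "lq_bound 1 (W \<sigma> (L (trunc n u)))
        (C * (2 powr (real n * (\<sigma> - s)) * decay_sum \<delta> (W s (L u)) n))"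
      unfolding trunc_def by (rule C(2))
  qed
qed

text \<open>
  High frequencies, measured in an index below \<open>s\<close>. The weight \<open>2 powr (n * (\<sigma> - s))\<close> and the sequence
  \<open>decay_sum\<close> are those of the low frequencies, so the two estimates can be added after rescaling.
\<close>

lemma diff_trunc_l1_bound:
  assumes \<sigma>: "a \<le> \<sigma>" "\<sigma> + \<delta> \<le> s" and \<delta>: "0 < \<delta>"
  obtains C where "0 < C" "\<And>u n. u \<in> X s \<Longrightarrow>
    lq_bound 1 (W \<sigma> (L (u - trunc n u))) (C * (2 powr (real n * (\<sigma> - s)) * decay_sum \<delta> (W s (L u)) n))"
proof -
  obtain C where C: "0 < C" "\<And>f c. lq_bound 1 (W \<sigma> f) c \<Longrightarrow> lq_bound 1 (W \<sigma> (L (R f))) (C * c)"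
    using LR_l1_bound[of \<sigma>] assms by auto
  show thesis
  proof (rule that[OF C(1)])
    fix u n assume u: "u \<in> X s"
    have ua: "u \<in> X a" using X_decreasing[of a s] assms u by auto
    obtain c where c: "lq_bound q (W s (L u)) c" using W_L_bounded[of s u] u \<sigma> \<delta> by auto
    have "(real k - real n) * (\<sigma> - s) \<le> - \<delta> * \<bar>real n - real k\<bar>" if "n \<le> k" for k
      using mult_left_mono[of \<delta> "s - \<sigma>" "real k - real n"] \<sigma> that by (simp add: algebra_simps)
    then have "lq_bound 1 (W \<sigma> (tail n (L u)))
        (2 powr (real n * (\<sigma> - s)) * decay_sum \<delta> (W s (L u)) n)"
      by (intro l1_bound_decay_sum[OF \<delta> c])
        (auto simp: tail_def NE_zero NE_nonneg not_less split: if_splits)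
    then show "lq_bound 1 (W \<sigma> (L (u - trunc n u)))
        (C * (2 powr (real n * (\<sigma> - s)) * decay_sum \<delta> (W s (L u)) n))"
      unfolding diff_trunc[OF ua] by (rule C(2))
  qed
qed

lemma decay_sum_bound:
  assumes s: "a \<le> s" and \<delta>: "0 < \<delta>"
  obtains C where "0 < C" "\<And>u. u \<in> X s \<Longrightarrow> lq_bound q (decay_sum \<delta> (W s (L u))) (C * NX s u)"
proof -
  obtain C where C: "0 < C" "\<And>u. u \<in> X s \<Longrightarrow> lq_bound q (W s (L u)) (C * NX s u)"
    using L_norm_bound[OF s] by blast
  show thesis
  proof (rule that)
    show "0 < 2 / (1 - 2 powr - \<delta>) * C" using \<delta> C powr_less_one[of 2 "-\<delta>"] by simp
    show "lq_bound q (decay_sum \<delta> (W s (L u))) (2 / (1 - 2 powr - \<delta>) * C * NX s u)" if "u \<in> X s" for u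
      using lq_bound_decay_sum[OF \<delta> C(2)[OF that] W_nonneg q_ge_1] by (simp add: mult.assoc)
  qed
qed

text \<open>
  Losing regularity turns summability of exponent \<open>q\<close> into summability of exponent 1: the weighted
  \<open>\<ell>\<^sup>1\<close> norm of index \<open>\<sigma>\<close> is the term of the kernel sum at \<open>n = 0\<close>.
\<close>

lemma l1_embedding:
  assumes \<sigma>: "a \<le> \<sigma>" "\<sigma> < s"
  obtains C where "0 < C" "\<And>u. u \<in> X s \<Longrightarrow> lq_bound 1 (W \<sigma> (L u)) (C * NX s u)"
proof -
  define \<delta> where "\<delta> = s - \<sigma>"
  have \<delta>: "0 < \<delta>" using \<sigma> by (simp add: \<delta>_def)
  obtain C where C: "0 < C" "\<And>u. u \<in> X s \<Longrightarrow> lq_bound q (decay_sum \<delta> (W s (L u))) (C * NX s u)"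
    using decay_sum_bound[of s \<delta>] \<sigma> \<delta> by auto
  show thesis
  proof (rule that[OF C(1)])
    fix u assume u: "u \<in> X s"
    obtain c where c: "lq_bound q (W s (L u)) c" using W_L_bounded[of s u] u \<sigma> by auto
    have "lq_bound 1 (W \<sigma> (L u)) (2 powr (real 0 * (\<sigma> - s)) * decay_sum \<delta> (W s (L u)) 0)"
      by (rule l1_bound_decay_sum[OF \<delta> c]) (auto simp: \<delta>_def algebra_simps)
    moreover have "decay_sum \<delta> (W s (L u)) 0 \<le> C * NX s u"
      using lq_bound_coord[OF C(2)[OF u] decay_sum_nonneg[OF \<delta> c W_nonneg q_ge_1] q_ge_1] .
    ultimately show "lq_bound 1 (W \<sigma> (L u)) (C * NX s u)"
      by (elim lq_bound_mono) (auto simp: W_nonneg)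
  qed
qed

end

section \<open>Interpolation and continuity of tame maps\<close>

text \<open>
  The constants are parameters here, so that the constants of the derived estimates can be stated
  to be independent of the points \<open>v\<close> and \<open>w\<close> and of the frequency.
\<close>

locale tame_map =
  X: pseudo_normed_scale scaleE NE scaleX X NX a q LX RX +
  Y: pseudo_normed_scale scaleF NF scaleY Y NY a q LY RY
  for scaleE :: "'k::real_normed_field \<Rightarrow> 'e::ab_group_add \<Rightarrow> 'e"
    and NE :: "'e \<Rightarrow> real"
    and scaleX :: "'k \<Rightarrow> 'x::ab_group_add \<Rightarrow> 'x"
    and X :: "real \<Rightarrow> 'x set" and NX :: "real \<Rightarrow> 'x \<Rightarrow> real"
    and a :: real and q :: ennreal
    and LX :: "'x \<Rightarrow> nat \<Rightarrow> 'e" and RX :: "(nat \<Rightarrow> 'e) \<Rightarrow> 'x"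
    and scaleF :: "'k \<Rightarrow> 'f::ab_group_add \<Rightarrow> 'f"
    and NF :: "'f \<Rightarrow> real"
    and scaleY :: "'k \<Rightarrow> 'y::ab_group_add \<Rightarrow> 'y"
    and Y :: "real \<Rightarrow> 'y set" and NY :: "real \<Rightarrow> 'y \<Rightarrow> real"
    and LY :: "'y \<Rightarrow> nat \<Rightarrow> 'f" and RY :: "(nat \<Rightarrow> 'f) \<Rightarrow> 'y" +
  fixes s\<^sub>0 s s\<^sub>1 r :: real and \<Phi> :: "'x \<Rightarrow> 'y" and C\<^sub>0 C\<^sub>1 :: real
  assumes a_le: "a \<le> s\<^sub>0" and s0_less: "s\<^sub>0 < s" and less_s1: "s < s\<^sub>1"
    and \<Phi>_mem: "v \<in> pnorm_ball (X s) (NX s) r \<Longrightarrow> \<Phi> v \<in> Y s\<^sub>0"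
    and C0_pos: "0 < C\<^sub>0" and C1_pos: "0 < C\<^sub>1"
    and contraction: "v \<in> pnorm_ball (X s) (NX s) r \<Longrightarrow> w \<in> pnorm_ball (X s) (NX s) r \<Longrightarrow>
      scale_norm NF LY top s\<^sub>0 (\<Phi> v - \<Phi> w) \<le> ennreal C\<^sub>0 * scale_norm NE LX 1 s\<^sub>0 (v - w)"
    and tame: "v \<in> scale_smooth NE RX \<Longrightarrow> v \<in> pnorm_ball (X s) (NX s) r \<Longrightarrow>
      scale_norm NF LY top s\<^sub>1 (\<Phi> v) \<le> ennreal C\<^sub>1 * scale_norm NE LX 1 s\<^sub>1 v"
begin

abbreviation B :: "'x set" where "B \<equiv> pnorm_ball (X s) (NX s) r"

definition \<delta> :: real where "\<delta> = min (s - s\<^sub>0) (s\<^sub>1 - s)"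

lemma \<delta>_pos: "0 < \<delta>" and \<delta>_le: "s\<^sub>0 + \<delta> \<le> s" "s + \<delta> \<le> s\<^sub>1"
  using s0_less less_s1 by (auto simp: \<delta>_def)

lemma a_le_s: "a \<le> s"
  using a_le s0_less by simp

lemma B_subset: "v \<in> B \<Longrightarrow> v \<in> X s" "v \<in> B \<Longrightarrow> v \<in> X a"
  using X.X_decreasing[of a s] a_le_s by (auto simp: pnorm_ball_def)

lemma \<Phi>_mem_Ya: "v \<in> B \<Longrightarrow> \<Phi> v \<in> Y a"
  using \<Phi>_mem Y.X_decreasing[of a s\<^sub>0] a_le by auto

text \<open>
  The contraction and the tame estimate have the same form, a bound of a norm with exponent
  \<open>top\<close> by one with exponent 1; only this consequence for single coordinates is used.
\<close>

lemma coordinate_bound: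
  assumes top1: "scale_norm NF LY top \<sigma> y \<le> ennreal C * scale_norm NE LX 1 \<sigma> x"
    and x: "lq_bound 1 (X.W \<sigma> (LX x)) c" and C: "0 < C"
  shows "Y.W \<sigma> (LY y) k \<le> C * c"
proof -
  have c: "0 \<le> c" by (rule lq_bound_nonneg[OF x])
  note top1
  also have "ennreal C * scale_norm NE LX 1 \<sigma> x \<le> ennreal C * ennreal c"
    unfolding scale_norm_def using x c X.Sigma_norm_NE_le_iff by (intro mult_left_mono) auto
  also have "\<dots> = ennreal (C * c)" using C c by (simp add: ennreal_mult)
  finally have "lq_bound top (Y.W \<sigma> (LY y)) (C * c)"
    unfolding scale_norm_def using C c Y.Sigma_norm_NE_le_iff by auto
  then show ?thesis by (simp add: lq_bound_def)
qed

text \<open>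
  The interpolation step. At frequency \<open>n\<close>, write \<open>\<Phi> v = (\<Phi> v - \<Phi> (trunc n v)) + \<Phi> (trunc n v)\<close>, with
  the cut-off at the same frequency \<open>n\<close>. The contraction bounds the first summand in the weight of
  index \<open>s\<^sub>0\<close> by the high frequencies of \<open>v\<close>, the tame estimate the second one in the weight of
  index \<open>s\<^sub>1\<close> by its low frequencies. After rescaling to the index \<open>s\<close> both bounds are multiples of
  the same kernel sum.
\<close>

lemma pointwise_bound:
  obtains C where "0 < C" "\<And>v n. v \<in> B \<Longrightarrow> X.trunc n v \<in> B \<Longrightarrow>
    Y.W s (LY (\<Phi> v)) n \<le> C * decay_sum \<delta> (X.W s (LX v)) n"
proof -
  obtain K where K: "0 < K" "\<And>u n. u \<in> X s \<Longrightarrow> lq_bound 1 (X.W s\<^sub>1 (LX (X.trunc n u)))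
      (K * (2 powr (real n * (s\<^sub>1 - s)) * decay_sum \<delta> (X.W s (LX u)) n))"
    using X.trunc_l1_bound[OF a_le_s \<delta>_le(2) \<delta>_pos] by blast
  obtain K' where K': "0 < K'" "\<And>u n. u \<in> X s \<Longrightarrow> lq_bound 1 (X.W s\<^sub>0 (LX (u - X.trunc n u)))
      (K' * (2 powr (real n * (s\<^sub>0 - s)) * decay_sum \<delta> (X.W s (LX u)) n))"
    using X.diff_trunc_l1_bound[OF a_le \<delta>_le(1) \<delta>_pos] by blast
  show thesis
  proof (rule that[of "C\<^sub>0 * K' + C\<^sub>1 * K"])
    show "0 < C\<^sub>0 * K' + C\<^sub>1 * K" using K K' C0_pos C1_pos by (simp add: add_pos_pos)
    fix v n assume v: "v \<in> B" and t: "X.trunc n v \<in> B"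
    let ?t = "X.trunc n v" and ?D = "decay_sum \<delta> (X.W s (LX v)) n"
    have "Y.W s\<^sub>0 (LY (\<Phi> v - \<Phi> ?t)) n \<le> C\<^sub>0 * (K' * (2 powr (real n * (s\<^sub>0 - s)) * ?D))"
      by (rule coordinate_bound[OF contraction[OF v t] K'(2)[OF B_subset(1)[OF v]] C0_pos])
    then have "Y.W s (LY (\<Phi> v - \<Phi> ?t)) n
        \<le> 2 powr (real n * (s - s\<^sub>0)) * (C\<^sub>0 * (K' * (2 powr (real n * (s\<^sub>0 - s)) * ?D)))"
      unfolding weighted_change_exponent[of NF s _ n s\<^sub>0] by (intro mult_left_mono) auto
    also have "\<dots> = (2 powr (real n * (s - s\<^sub>0)) * 2 powr (real n * (s\<^sub>0 - s))) * (C\<^sub>0 * K' * ?D)"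
      by simp
    also have "\<dots> = C\<^sub>0 * K' * ?D" unfolding powr_add[symmetric] by (simp add: algebra_simps)
    finally have 1: "Y.W s (LY (\<Phi> v - \<Phi> ?t)) n \<le> C\<^sub>0 * K' * ?D" .
    have "Y.W s\<^sub>1 (LY (\<Phi> ?t)) n \<le> C\<^sub>1 * (K * (2 powr (real n * (s\<^sub>1 - s)) * ?D))"
      by (rule coordinate_bound[OF tame[OF X.trunc_smooth t] K(2)[OF B_subset(1)[OF v]] C1_pos])
    then have "Y.W s (LY (\<Phi> ?t)) n
        \<le> 2 powr (real n * (s - s\<^sub>1)) * (C\<^sub>1 * (K * (2 powr (real n * (s\<^sub>1 - s)) * ?D)))"
      unfolding weighted_change_exponent[of NF s _ n s\<^sub>1] by (intro mult_left_mono) auto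
    also have "\<dots> = (2 powr (real n * (s - s\<^sub>1)) * 2 powr (real n * (s\<^sub>1 - s))) * (C\<^sub>1 * K * ?D)"
      by simp
    also have "\<dots> = C\<^sub>1 * K * ?D" unfolding powr_add[symmetric] by (simp add: algebra_simps)
    finally have 2: "Y.W s (LY (\<Phi> ?t)) n \<le> C\<^sub>1 * K * ?D" .
    have "LY (\<Phi> v) = (\<lambda>k. LY (\<Phi> v - \<Phi> ?t) k + LY (\<Phi> ?t) k)"
      using Y.L_diff[OF \<Phi>_mem_Ya[OF v] \<Phi>_mem_Ya[OF t]] by blast
    then have "Y.W s (LY (\<Phi> v)) n \<le> Y.W s (LY (\<Phi> v - \<Phi> ?t)) n + Y.W s (LY (\<Phi> ?t)) n"
      using Y.W_add by metis
    then show "Y.W s (LY (\<Phi> v)) n \<le> (C\<^sub>0 * K' + C\<^sub>1 * K) * ?D"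
      using 1 2 by (simp add: algebra_simps)
  qed
qed

text \<open>
  The pointwise bound is only available for frequencies \<open>n\<close> with \<open>trunc n w \<in> B\<close>. For the continuity
  at \<open>v\<close>, the threshold for \<open>n\<close> must not depend on the nearby point \<open>w\<close>. By additivity \<open>trunc n w\<close> is
  \<open>trunc n (w - v) + trunc n v\<close>, where the first summand is small uniformly in \<open>n\<close> and the second one
  is close to \<open>v\<close> for large \<open>n\<close>.
\<close>

lemma trunc_mem_B_uniformly:
  assumes v: "v \<in> B"
  obtains \<rho> n\<^sub>0 where "0 < \<rho>" "\<And>w n. w \<in> X s \<Longrightarrow> NX s (w - v) < \<rho> \<Longrightarrow> n\<^sub>0 \<le> n \<Longrightarrow> X.trunc n w \<in> B"
proof -
  define \<epsilon> where "\<epsilon> = (r - NX s v) / 2"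
  have \<epsilon>: "0 < \<epsilon>" using v by (simp add: \<epsilon>_def pnorm_ball_def)
  note vX = B_subset[OF v]
  obtain n\<^sub>0 where n0: "\<And>n. n\<^sub>0 \<le> n \<Longrightarrow> NX s (v - X.trunc n v) \<le> \<epsilon>"
    using X.trunc_tendsto[OF a_le_s vX(1) \<epsilon>] by blast
  obtain C where C: "0 < C" "\<And>u n. u \<in> X s \<Longrightarrow> NX s (X.trunc n u) \<le> C * NX s u"
    using X.trunc_bound[OF a_le_s] by blast
  show thesis
  proof (rule that[of "\<epsilon> / C" n\<^sub>0])
    show "0 < \<epsilon> / C" using C \<epsilon> by simp
    fix w n assume w: "w \<in> X s" "NX s (w - v) < \<epsilon> / C" and n: "n\<^sub>0 \<le> n"
    have d: "w - v \<in> X s" using X.X_diff a_le_s w vX by blast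
    have t: "X.trunc n u \<in> X s" for u by (rule X.trunc_mem[OF a_le_s])
    have "X.trunc n w = X.trunc n (w - v) + X.trunc n v"
      using X.trunc_add[of "w - v" v n] d vX X.X_decreasing[of a s] a_le_s by auto
    also have "\<dots> = X.trunc n (w - v) + (v + - (v - X.trunc n v))"
      by simp
    finally have "NX s (X.trunc n w) \<le> NX s (X.trunc n (w - v)) + NX s (v + - (v - X.trunc n v))"
      using X.NX_add[OF a_le_s t, of "v + - (v - X.trunc n v)"] t by simp
    also have "NX s (v + - (v - X.trunc n v)) \<le> NX s v + NX s (v - X.trunc n v)"
      using X.NX_add[OF a_le_s, of v "- (v - X.trunc n v)"] X.NX_minus[OF a_le_s, of "v - X.trunc n v"]
        X.X_diff[OF a_le_s _ t] X.X_diff[OF a_le_s t] vX by simp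
    also have "NX s (X.trunc n (w - v)) \<le> C * NX s (w - v)" by (rule C(2)[OF d])
    also have "C * NX s (w - v) < \<epsilon>" using w C by (simp add: field_simps)
    finally have "NX s (X.trunc n w) < r" using n0[OF n] by (simp add: \<epsilon>_def field_simps)
    then show "X.trunc n w \<in> B" using t by (simp add: pnorm_ball_def)
  qed
qed

text \<open>
  The frequencies below the threshold are finitely many and do not influence membership.
\<close>

lemma maps_to_Ys:
  assumes v: "v \<in> B"
  shows "\<Phi> v \<in> Y s"
proof -
  note vX = B_subset[OF v]
  obtain C where C: "0 < C" "\<And>v n. v \<in> B \<Longrightarrow> X.trunc n v \<in> B \<Longrightarrow>
      Y.W s (LY (\<Phi> v)) n \<le> C * decay_sum \<delta> (X.W s (LX v)) n"
    using pointwise_bound by blast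
  \<comment> \<open>The uniform threshold is used here with \<open>w = v\<close>.\<close>
  have "NX s (v - v) = 0"
    using pseudo_normed_space.pnorm_eq_0_iff[OF X.pseudo_normed_X[OF a_le_s]]
      X.X_diff[OF a_le_s vX(1) vX(1)] by auto
  then obtain n\<^sub>0 where "\<And>n. n\<^sub>0 \<le> n \<Longrightarrow> X.trunc n v \<in> B"
    using trunc_mem_B_uniformly[OF v] vX(1) by metis
  then have le: "Y.W s (LY (\<Phi> v)) n \<le> C * decay_sum \<delta> (X.W s (LX v)) n" if "n\<^sub>0 \<le> n" for n
    using C(2)[OF v] that by blast
  obtain c where c: "lq_bound q (X.W s (LX v)) c"
    using X.W_L_bounded[OF a_le_s vX(1)] by blast
  have "lq_vanishing q (decay_sum \<delta> (X.W s (LX v)))"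
    by (intro lq_vanishing_decay_sum \<delta>_pos X.W_L_vanishing a_le_s vX X.W_nonneg X.q_ge_1)
  from this Y.W_nonneg decay_sum_nonneg[OF \<delta>_pos c X.W_nonneg X.q_ge_1] le
  have "lq_vanishing q (Y.W s (LY (\<Phi> v)))"
    using C(1) X.q_ge_1 by (rule lq_vanishing_dominated[OF _ _ _ _ less_imp_le])
  then have "RY (LY (\<Phi> v)) \<in> Y s"
    using Y.L_R_bounds[OF a_le_s] Y.mem_Sigma_space_iff[OF Y.q_ge_1] by blast
  then show ?thesis using Y.R_L[OF \<Phi>_mem_Ya[OF v]] by simp
qed

text \<open>
  The kernel sum of \<open>w\<close> is split as well, so that the bound depends on \<open>w\<close> only through \<open>w - v\<close>.
\<close>

lemma diff_pointwise_bound: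
  obtains C where "0 < C" "\<And>v w n. v \<in> B \<Longrightarrow> w \<in> B \<Longrightarrow> X.trunc n v \<in> B \<Longrightarrow> X.trunc n w \<in> B \<Longrightarrow>
    Y.W s (LY (\<Phi> w - \<Phi> v)) n
      \<le> C * (2 * decay_sum \<delta> (X.W s (LX v)) n + decay_sum \<delta> (X.W s (LX (w - v))) n)"
proof -
  obtain C where C: "0 < C" "\<And>v n. v \<in> B \<Longrightarrow> X.trunc n v \<in> B \<Longrightarrow>
      Y.W s (LY (\<Phi> v)) n \<le> C * decay_sum \<delta> (X.W s (LX v)) n"
    using pointwise_bound by blast
  show thesis
  proof (rule that[OF C(1)])
    fix v w n assume v: "v \<in> B" "X.trunc n v \<in> B" and w: "w \<in> B" "X.trunc n w \<in> B"
    note vX = B_subset[OF v(1)] and wX = B_subset[OF w(1)]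
    let ?d = "\<lambda>u. decay_sum \<delta> (X.W s (LX u)) n"
    have d: "w - v \<in> X s" using X.X_diff a_le_s wX vX by blast
    obtain c where c: "lq_bound q (X.W s (LX v)) c"
      using X.W_L_bounded[OF a_le_s vX(1)] by blast
    obtain c' where c': "lq_bound q (X.W s (LX (w - v))) c'"
      using X.W_L_bounded[OF a_le_s d] by blast
    have "LX w = (\<lambda>k. LX (w - v) k + LX v k)"
      using X.L_diff[OF wX(2) vX(2)] by blast
    then have "X.W s (LX w) k \<le> X.W s (LX v) k + X.W s (LX (w - v)) k" for k
      using X.W_add[of s "LX (w - v)" "LX v" k] by simp
    then have dw: "?d w \<le> ?d v + ?d (w - v)"
      by (intro decay_sum_le_add[OF \<delta>_pos X.q_ge_1 c c'] X.W_nonneg)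
    have "NF (LY (\<Phi> w - \<Phi> v) n) = NF (LY (\<Phi> w) n + - LY (\<Phi> v) n)"
      using Y.L_diff[OF \<Phi>_mem_Ya[OF w(1)] \<Phi>_mem_Ya[OF v(1)], of n] by simp
    also have "\<dots> \<le> NF (LY (\<Phi> w) n) + NF (LY (\<Phi> v) n)"
      using Y.NE_add[of "LY (\<Phi> w) n" "- LY (\<Phi> v) n"] Y.E.pnorm_minus by simp
    finally have "Y.W s (LY (\<Phi> w - \<Phi> v)) n \<le> Y.W s (LY (\<Phi> w)) n + Y.W s (LY (\<Phi> v)) n"
      unfolding weighted_def distrib_left[symmetric] by (intro mult_left_mono) auto
    also have "\<dots> \<le> C * ?d w + C * ?d v" by (intro add_mono C(2) v w)
    also have "\<dots> \<le> C * (?d v + ?d (w - v)) + C * ?d v"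
      using dw C by simp
    finally show "Y.W s (LY (\<Phi> w - \<Phi> v)) n \<le> C * (2 * ?d v + ?d (w - v))"
      by (simp add: algebra_simps)
  qed
qed

text \<open>
  For each fixed frequency, \<open>\<Phi>\<close> is Lipschitz; the constant grows exponentially with the frequency.
\<close>

lemma contraction_bound:
  obtains C where "0 < C" "\<And>v w n. v \<in> B \<Longrightarrow> w \<in> B \<Longrightarrow>
    Y.W s (LY (\<Phi> w - \<Phi> v)) n \<le> 2 powr (real n * (s - s\<^sub>0)) * (C * NX s (w - v))"
proof -
  obtain K where K: "0 < K" "\<And>u. u \<in> X s \<Longrightarrow> lq_bound 1 (X.W s\<^sub>0 (LX u)) (K * NX s u)"
    using X.l1_embedding[OF a_le s0_less] by blast
  show thesis
  proof (rule that[of "C\<^sub>0 * K"])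
    fix v w n assume v: "v \<in> B" and w: "w \<in> B"
    have "w - v \<in> X s" using X.X_diff a_le_s B_subset v w by blast
    then have "Y.W s\<^sub>0 (LY (\<Phi> w - \<Phi> v)) n \<le> C\<^sub>0 * (K * NX s (w - v))"
      by (intro coordinate_bound[OF contraction[OF w v] K(2) C0_pos])
    then show "Y.W s (LY (\<Phi> w - \<Phi> v)) n \<le> 2 powr (real n * (s - s\<^sub>0)) * (C\<^sub>0 * K * NX s (w - v))"
      unfolding weighted_change_exponent[of NF s _ n s\<^sub>0] by (intro mult_left_mono) (auto simp: mult.assoc)
  qed (use K C0_pos in simp)
qed

text \<open>
  First fix a frequency \<open>N\<close> beyond which the kernel sum of \<open>v\<close>, which does not depend on \<open>w\<close>, has a
  small norm. Above \<open>N\<close> the norm of \<open>\<Phi> w - \<Phi> v\<close> is then bounded by this tail and by the kernel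
  sum of \<open>w - v\<close>; the finitely many remaining frequencies are controlled by the Lipschitz bound.
  Hence \<open>\<rho>\<close> is chosen after \<open>N\<close>.
\<close>

lemma continuity_estimate:
  assumes v: "v \<in> B" and \<epsilon>: "0 < \<epsilon>"
  obtains \<rho> where "0 < \<rho>" "\<And>w. w \<in> B \<Longrightarrow> NX s (w - v) < \<rho> \<Longrightarrow> NY s (\<Phi> w - \<Phi> v) < \<epsilon>"
proof -
  note vX = B_subset[OF v]
  obtain C where C: "0 < C" "\<And>v w n. v \<in> B \<Longrightarrow> w \<in> B \<Longrightarrow> X.trunc n v \<in> B \<Longrightarrow> X.trunc n w \<in> B \<Longrightarrow>
      Y.W s (LY (\<Phi> w - \<Phi> v)) n
        \<le> C * (2 * decay_sum \<delta> (X.W s (LX v)) n + decay_sum \<delta> (X.W s (LX (w - v))) n)"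
    using diff_pointwise_bound by blast
  obtain K where K: "0 < K" "\<And>v w n. v \<in> B \<Longrightarrow> w \<in> B \<Longrightarrow>
      Y.W s (LY (\<Phi> w - \<Phi> v)) n \<le> 2 powr (real n * (s - s\<^sub>0)) * (K * NX s (w - v))"
    using contraction_bound by blast
  obtain A where A: "0 < A"
      "\<And>u. u \<in> X s \<Longrightarrow> lq_bound q (decay_sum \<delta> (X.W s (LX u))) (A * NX s u)"
    using X.decay_sum_bound[OF a_le_s \<delta>_pos] by blast
  obtain D where D: "0 < D" "\<And>f c. f \<in> Sigma_space NF q s \<Longrightarrow> lq_bound q (Y.W s f) c \<Longrightarrow>
      NY s (RY f) \<le> D * c"
    using Y.R_norm_bound[OF a_le_s] by blast
  obtain \<rho>\<^sub>0 n\<^sub>0 where n0: "0 < \<rho>\<^sub>0"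
      "\<And>w n. w \<in> X s \<Longrightarrow> NX s (w - v) < \<rho>\<^sub>0 \<Longrightarrow> n\<^sub>0 \<le> n \<Longrightarrow> X.trunc n w \<in> B"
    using trunc_mem_B_uniformly[OF v] by blast
  have "NX s (v - v) = 0"
    using pseudo_normed_space.pnorm_eq_0_iff[OF X.pseudo_normed_X[OF a_le_s]]
      X.X_diff[OF a_le_s vX(1) vX(1)] by auto
  then have tv: "X.trunc n v \<in> B" if "n\<^sub>0 \<le> n" for n
    using n0 vX(1) that by metis
  have nn: "0 \<le> decay_sum \<delta> (X.W s (LX u)) n" if u: "u \<in> X s" for u n
  proof -
    obtain c where "lq_bound q (X.W s (LX u)) c" using X.W_L_bounded[OF a_le_s u] by blast
    then show ?thesis by (rule decay_sum_nonneg[OF \<delta>_pos _ X.W_nonneg X.q_ge_1])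
  qed
  \<comment> \<open>Each of the two parts below has norm at most \<open>2 * \<eta>\<close>; together, with the factor 2 of the
    triangle inequality, they contribute \<open>4 * \<eta>\<close>, and \<open>RY\<close> costs a factor \<open>D\<close>.\<close>
  define \<eta> where "\<eta> = \<epsilon> / (5 * D)"
  have \<eta>: "0 < \<eta>" using \<epsilon> D by (simp add: \<eta>_def)
  define \<eta>' where "\<eta>' = \<eta> / (4 * C)"
  have \<eta>': "0 < \<eta>'" using \<eta> C by (simp add: \<eta>'_def)
  have "lq_vanishing q (decay_sum \<delta> (X.W s (LX v)))"
    by (intro lq_vanishing_decay_sum \<delta>_pos X.W_L_vanishing a_le_s vX X.W_nonneg X.q_ge_1)
  then obtain M where M: "lq_bound q (\<lambda>n. if n < M then 0 else decay_sum \<delta> (X.W s (LX v)) n) \<eta>'"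
    using \<eta>' unfolding lq_vanishing_def by blast
  define N where "N = max M n\<^sub>0"
  define b where "b = 2 powr (real N * (s - s\<^sub>0)) * K"
  have b: "0 < b" using K by (simp add: b_def)
  define \<rho> where "\<rho> = min \<rho>\<^sub>0 (min (\<eta>' / A) (2 * \<eta> / (real (Suc N) * b)))"
  show thesis
  proof (rule that[of \<rho>])
    show "0 < \<rho>" using n0 \<eta> \<eta>' A b by (simp add: \<rho>_def)
    fix w assume w: "w \<in> B" and d: "NX s (w - v) < \<rho>"
    note wX = B_subset[OF w]
    have dX: "w - v \<in> X s" using X.X_diff a_le_s wX vX by blast
    let ?x = "\<lambda>u. decay_sum \<delta> (X.W s (LX u))"
    let ?t = "\<lambda>n. 2 * (if n < M then 0 else ?x v n)"
    let ?h = "\<lambda>n. if n < Suc N then b * NX s (w - v) else 0"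
    let ?y = "Y.W s (LY (\<Phi> w - \<Phi> v))"
    have d0: "0 \<le> NX s (w - v)" by (rule X.NX_nonneg[OF a_le_s dX])
    have "A * NX s (w - v) \<le> 2 * \<eta>'"
      using d A \<eta>' by (simp add: \<rho>_def field_simps)
    then have 1: "lq_bound q (?x (w - v)) (2 * \<eta>')"
      by (intro lq_bound_mono[OF A(2)[OF dX]] nn dX X.q_ge_1) auto
    have 2: "lq_bound q ?t (2 * \<eta>')"
      using nn[OF vX(1)] by (intro lq_bound_cmult[OF M]) auto
    have "lq_bound q (\<lambda>n. ?t n + ?x (w - v) n) (2 * (2 * \<eta>'))"
      using nn[OF vX(1)] nn[OF dX] by (intro lq_bound_add[OF 2 1 X.q_ge_1]) auto
    then have "lq_bound q (\<lambda>n. C * (?t n + ?x (w - v) n)) (C * (2 * (2 * \<eta>')))"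
      using nn[OF vX(1)] nn[OF dX] C by (intro lq_bound_cmult) auto
    also have "C * (2 * (2 * \<eta>')) = \<eta>" using C by (simp add: \<eta>'_def)
    finally have 3: "lq_bound q (\<lambda>n. C * (?t n + ?x (w - v) n)) (2 * \<eta>)"
      using nn[OF vX(1)] nn[OF dX] C \<eta> by (elim lq_bound_mono) (auto intro: X.q_ge_1)
    have "real (Suc N) * (b * NX s (w - v)) \<le> 2 * \<eta>"
    proof -
      have "NX s (w - v) < 2 * \<eta> / (real (Suc N) * b)" using d by (simp add: \<rho>_def)
      then have "NX s (w - v) * (real (Suc N) * b) < 2 * \<eta>"
        using b by (subst (asm) pos_less_divide_eq) auto
      then show ?thesis by (simp add: mult_ac)
    qed
    then have 4: "lq_bound q ?h (2 * \<eta>)"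
      using d0 b by (intro lq_bound_mono[OF lq_bound_head[OF X.q_ge_1, of "b * NX s (w - v)" "Suc N"]] X.q_ge_1)
        auto
    have 5: "lq_bound q (\<lambda>n. C * (?t n + ?x (w - v) n) + ?h n) (2 * (2 * \<eta>))"
      using nn[OF vX(1)] nn[OF dX] C d0 b by (intro lq_bound_add[OF 3 4 X.q_ge_1]) auto
    have le: "?y n \<le> C * (?t n + ?x (w - v) n) + ?h n" for n
    proof (cases "n < Suc N")
      case True
      have "?y n \<le> 2 powr (real n * (s - s\<^sub>0)) * (K * NX s (w - v))" by (rule K(2)[OF v w])
      also have "\<dots> \<le> 2 powr (real N * (s - s\<^sub>0)) * (K * NX s (w - v))"
        using True s0_less d0 K by (intro mult_right_mono powr_mono) auto
      finally have "?y n \<le> b * NX s (w - v)" by (simp add: b_def mult.assoc)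
      moreover have "0 \<le> C * (?t n + ?x (w - v) n)"
        using nn[OF vX(1)] nn[OF dX] C by simp
      ultimately show ?thesis using True by simp
    next
      case False
      then have "n\<^sub>0 \<le> n" "M \<le> n" by (auto simp: N_def)
      then show ?thesis
        using C(2)[OF v w tv n0(2)[OF wX(1)]] d False by (simp add: \<rho>_def)
    qed
    have 6: "lq_bound q ?y (4 * \<eta>)"
      by (rule lq_bound_mono[OF 5 Y.W_nonneg le _ X.q_ge_1]) simp
    have Yd: "\<Phi> w - \<Phi> v \<in> Y s"
      by (intro Y.X_diff a_le_s maps_to_Ys v w)
    then have "NY s (RY (LY (\<Phi> w - \<Phi> v))) \<le> D * (4 * \<eta>)"
      by (intro D(2) Y.L_mem_Sigma_space a_le_s 6)
    moreover have "\<Phi> w - \<Phi> v \<in> Y a" using Yd Y.X_decreasing[of a s] a_le_s by auto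
    ultimately have "NY s (\<Phi> w - \<Phi> v) \<le> D * (4 * \<eta>)" by (simp add: Y.R_L)
    also have "\<dots> < \<epsilon>" using D \<epsilon> by (simp add: \<eta>_def)
    finally show "NY s (\<Phi> w - \<Phi> v) < \<epsilon>" .
  qed
qed

lemma continuous_map_ball:
  "continuous_map (subtopology (pnorm_topology (X s) (NX s)) B) (pnorm_topology (Y s) (NY s)) \<Phi>"
proof -
  interpret MX: Metric_space "X s" "pnorm_dist (X s) (NX s)"
    by (rule pseudo_normed_space.Metric_space_pnorm[OF X.pseudo_normed_X[OF a_le_s]])
  interpret MY: Metric_space "Y s" "pnorm_dist (Y s) (NY s)"
    by (rule pseudo_normed_space.Metric_space_pnorm[OF Y.pseudo_normed_X[OF a_le_s]])
  show ?thesis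
    unfolding pnorm_topology_def MY.continuous_map_to_metric
  proof (intro ballI allI impI)
    fix v \<epsilon> assume "v \<in> topspace (subtopology MX.mtopology B)" and \<epsilon>: "(0::real) < \<epsilon>"
    then have v: "v \<in> B" by simp
    then obtain \<rho> where \<rho>: "0 < \<rho>" "\<And>w. w \<in> B \<Longrightarrow> NX s (w - v) < \<rho> \<Longrightarrow> NY s (\<Phi> w - \<Phi> v) < \<epsilon>"
      using continuity_estimate \<epsilon> by blast
    show "\<exists>U. openin (subtopology MX.mtopology B) U \<and> v \<in> U \<and> (\<forall>w\<in>U. \<Phi> w \<in> MY.mball (\<Phi> v) \<epsilon>)"
    proof (intro exI conjI ballI)
      show "openin (subtopology MX.mtopology B) (B \<inter> MX.mball v \<rho>)"
        using MX.openin_mball by (rule openin_subtopology_Int2)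
      show "v \<in> B \<inter> MX.mball v \<rho>" using v \<rho> B_subset by simp
      fix w assume "w \<in> B \<inter> MX.mball v \<rho>"
      then have w: "w \<in> B" and "pnorm_dist (X s) (NX s) w v < \<rho>"
        by (auto simp: MX.commute)
      then have "NX s (w - v) < \<rho>" using B_subset v by (simp add: pnorm_dist_def)
      then have "pnorm_dist (Y s) (NY s) (\<Phi> w) (\<Phi> v) < \<epsilon>"
        using \<rho>(2)[OF w] maps_to_Ys v w by (simp add: pnorm_dist_def)
      then show "\<Phi> w \<in> MY.mball (\<Phi> v) \<epsilon>"
        using maps_to_Ys v w by (simp add: MY.commute)
    qed
  qed
qed

end

theorem theorem18:
  fixes scaleE :: "'k::real_normed_field \<Rightarrow> 'e::ab_group_add \<Rightarrow> 'e"
    and scaleF :: "'k \<Rightarrow> 'f::ab_group_add \<Rightarrow> 'f"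
    and scaleX :: "'k \<Rightarrow> 'x::ab_group_add \<Rightarrow> 'x"
    and scaleY :: "'k \<Rightarrow> 'y::ab_group_add \<Rightarrow> 'y"
    and NE :: "'e \<Rightarrow> real" and NF :: "'f \<Rightarrow> real"
    and X :: "real \<Rightarrow> 'x set" and NX :: "real \<Rightarrow> 'x \<Rightarrow> real"
    and Y :: "real \<Rightarrow> 'y set" and NY :: "real \<Rightarrow> 'y \<Rightarrow> real"
    and a s\<^sub>0 s s\<^sub>1 r :: real and q :: ennreal
    and LX :: "'x \<Rightarrow> nat \<Rightarrow> 'e" and RX :: "(nat \<Rightarrow> 'e) \<Rightarrow> 'x"
    and LY :: "'y \<Rightarrow> nat \<Rightarrow> 'f" and RY :: "(nat \<Rightarrow> 'f) \<Rightarrow> 'y"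
    and \<Phi> :: "'x \<Rightarrow> 'y"
  assumes scale_X: "pseudo_normed_scale scaleE NE scaleX X NX a q LX RX"
    and scale_Y: "pseudo_normed_scale scaleF NF scaleY Y NY a q LY RY"
    and "a \<le> s\<^sub>0" and "s\<^sub>0 < s" and "s < s\<^sub>1" and "r > 0"
    and \<Phi>_maps: "\<And>v. v \<in> pnorm_ball (X s) (NX s) r \<Longrightarrow> \<Phi> v \<in> Y s\<^sub>0"
    and contraction: "\<exists>C\<^sub>0>0. \<forall>v \<in> pnorm_ball (X s) (NX s) r. \<forall>w \<in> pnorm_ball (X s) (NX s) r.
      scale_norm NF LY top s\<^sub>0 (\<Phi> v - \<Phi> w) \<le> ennreal C\<^sub>0 * scale_norm NE LX 1 s\<^sub>0 (v - w)"
    and tame: "\<exists>C\<^sub>1>0. \<forall>v \<in> scale_smooth NE RX \<inter> pnorm_ball (X s) (NX s) r.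
      scale_norm NF LY top s\<^sub>1 (\<Phi> v) \<le> ennreal C\<^sub>1 * scale_norm NE LX 1 s\<^sub>1 v"
  shows "(\<forall>v \<in> pnorm_ball (X s) (NX s) r. \<Phi> v \<in> Y s) \<and>
    continuous_map (subtopology (pnorm_topology (X s) (NX s)) (pnorm_ball (X s) (NX s) r))
      (pnorm_topology (Y s) (NY s)) \<Phi>"
proof -
  obtain C\<^sub>0 where C0: "0 < C\<^sub>0"
    "\<And>v w. v \<in> pnorm_ball (X s) (NX s) r \<Longrightarrow> w \<in> pnorm_ball (X s) (NX s) r \<Longrightarrow>
      scale_norm NF LY top s\<^sub>0 (\<Phi> v - \<Phi> w) \<le> ennreal C\<^sub>0 * scale_norm NE LX 1 s\<^sub>0 (v - w)"
    using contraction by blast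
  obtain C\<^sub>1 where C1: "0 < C\<^sub>1"
    "\<And>v. v \<in> scale_smooth NE RX \<Longrightarrow> v \<in> pnorm_ball (X s) (NX s) r \<Longrightarrow>
      scale_norm NF LY top s\<^sub>1 (\<Phi> v) \<le> ennreal C\<^sub>1 * scale_norm NE LX 1 s\<^sub>1 v"
    using tame by blast
  interpret tame_map scaleE NE scaleX X NX a q LX RX scaleF NF scaleY Y NY LY RY s\<^sub>0 s s\<^sub>1 r \<Phi> C\<^sub>0 C\<^sub>1
    using assms(3-5) \<Phi>_maps C0 C1
    by (intro tame_map.intro[OF scale_X scale_Y] tame_map_axioms.intro) auto
  show ?thesis using maps_to_Ys continuous_map_ball by blast
qed

end
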